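(* Let $d\ge3$, $\delta\in(0,1)$, and $\alpha>\frac34\cdot\frac{d-\frac23}{d-1}$ with $\alpha<1$. Then \[ \big\|\mathcal{L}(\mathcal{H}_\alpha)-\widetilde\nu_{\alpha,n}\big\|_{\mathrm{TV}}\to0\quad\text{as }n\to\infty. \]
   Context: Let $(\phi_x)$ be the discrete Gaussian free field on $[0,n]^d\cap\mathbb{Z}^d$ with zero boundary condition on $\partial[0,n]^d$: a centred Gaussian process with $\mathrm{Cov}(\phi_x,\phi_y)=\mathbb{E}_x\big[\sum_{i=0}^{\tau}\mathbf 1(X_i=y)\big]$, where $X$ is simple random walk on $[0,n]^d\cap\mathbb{Z}^d$ and $\tau$ its first hitting time of $\partial[0,n]^d\cap\mathbb{Z}^d$. Let $G$ be the Green's function of simple random walk on $\mathbb{Z}^d$ and $G(0)=G(0,0)$. The set of $\alpha$-high points is $\mathcal{H}_\alpha=\{x\in[\delta n,(1-\delta)n]^d\cap\mathbb{Z}^d:\phi_x\ge\sqrt{2\alpha dG(0)\log n}\}$. $\widetilde\nu_{\alpha,n}$ is the law of $\{x\in[\delta n,(1-\delta)n]^d\cap\mathbb{Z}^d:\widetilde Z_x=1\}$ where $(\widetilde Z_x)$ are independent Bernoulli with $\mathbb{P}(\widetilde Z_x=1)=\mathbb{P}(\phi_x\ge\sqrt{2\alpha dG(0)\log n})$. Total variation distance: $\|\mu-\nu\|_{\mathrm{TV}}=\max_A|\mu(A)-\nu(A)|$. *)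

theory Defs
  imports "HOL-Probability.Probability"
begin

text \<open>Lattice points of Z^d are vectors of type int ^ 'd; d = CARD('d).\<close>

definition lat_adj :: "int ^ 'd \<Rightarrow> int ^ 'd \<Rightarrow> bool" where
  "lat_adj x z \<longleftrightarrow> (\<Sum>i\<in>UNIV. \<bar>z $ i - x $ i\<bar>) = 1"

definition box_int :: "nat \<Rightarrow> (int ^ 'd::finite) set" where
  "box_int n = {x. \<forall>i. 0 < x $ i \<and> x $ i < int n}"

definition bulk :: "real \<Rightarrow> nat \<Rightarrow> (int ^ 'd::finite) set" where
  "bulk \<delta> n = {x. \<forall>i. \<delta> * real n \<le> real_of_int (x $ i) \<and> real_of_int (x $ i) \<le> (1 - \<delta>) * real n}"

text \<open>k-step transition probability of SRW on Z^d killed on exiting the interior of the box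
  (from interior x, stays in the interior up to time k, ends at y).\<close>
fun kill_step :: "nat \<Rightarrow> nat \<Rightarrow> int ^ 'd::finite \<Rightarrow> int ^ 'd \<Rightarrow> real" where
  "kill_step n 0 x y = (if x = y then 1 else 0)"
| "kill_step n (Suc k) x y =
     (\<Sum>z\<in>{z \<in> box_int n. lat_adj x z}. kill_step n k z y / (2 * real CARD('d)))"

text \<open>Green's function of SRW killed at the boundary: expected number of visits to y before tau,
  for interior points x, y.\<close>
definition green_box :: "nat \<Rightarrow> int ^ 'd::finite \<Rightarrow> int ^ 'd \<Rightarrow> real" where
  "green_box n x y = (\<Sum>k. kill_step n k x y)"

fun zd_step :: "nat \<Rightarrow> int ^ 'd::finite \<Rightarrow> int ^ 'd \<Rightarrow> real" where
  "zd_step 0 x y = (if x = y then 1 else 0)"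
| "zd_step (Suc k) x y = (\<Sum>z\<in>{z. lat_adj x z}. zd_step k z y / (2 * real CARD('d)))"

definition green0 :: "'d::finite itself \<Rightarrow> real" where
  "green0 _ = (\<Sum>k. zd_step k (0 :: int ^ 'd) 0)"

definition centred_gaussian_rv :: "'a measure \<Rightarrow> ('a \<Rightarrow> real) \<Rightarrow> real \<Rightarrow> bool" where
  "centred_gaussian_rv M X v \<longleftrightarrow> X \<in> borel_measurable M \<and>
     (if v = 0 then (AE \<omega> in M. X \<omega> = 0)
      else v > 0 \<and> distributed M lborel X (normal_density 0 (sqrt v)))"

text \<open>phi is a DGFF on [0,n]^d with zero boundary condition: a centred Gaussian process on the
  interior points with covariance green_box n (jointly Gaussian: every linear combination
  is centred Gaussian with the corresponding variance).  Boundary values are 0.\<close>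
definition is_dgff :: "nat \<Rightarrow> 'a measure \<Rightarrow> (int ^ 'd::finite \<Rightarrow> 'a \<Rightarrow> real) \<Rightarrow> bool" where
  "is_dgff n M \<phi> \<longleftrightarrow> prob_space M \<and>
     (\<forall>x. x \<notin> box_int n \<longrightarrow> (\<forall>\<omega>. \<phi> x \<omega> = 0)) \<and>
     (\<forall>c :: int ^ 'd \<Rightarrow> real.
        centred_gaussian_rv M (\<lambda>\<omega>. \<Sum>x\<in>box_int n. c x * \<phi> x \<omega>)
          (\<Sum>x\<in>box_int n. \<Sum>y\<in>box_int n. c x * c y * green_box n x y))"

definition hp_level :: "'d::finite itself \<Rightarrow> real \<Rightarrow> nat \<Rightarrow> real" where
  "hp_level t \<alpha> n = sqrt (2 * \<alpha> * real CARD('d) * green0 t * ln (real n))"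

definition high_points :: "real \<Rightarrow> real \<Rightarrow> nat \<Rightarrow> (int ^ 'd::finite \<Rightarrow> 'a \<Rightarrow> real) \<Rightarrow> 'a \<Rightarrow> (int ^ 'd) set" where
  "high_points \<delta> \<alpha> n \<phi> \<omega> = {x \<in> bulk \<delta> n. \<phi> x \<omega> \<ge> hp_level TYPE('d) \<alpha> n}"

definition bern_law :: "'a measure \<Rightarrow> real \<Rightarrow> real \<Rightarrow> nat \<Rightarrow> (int ^ 'd::finite \<Rightarrow> 'a \<Rightarrow> real)
    \<Rightarrow> (int ^ 'd) set set \<Rightarrow> real" where
  "bern_law M \<delta> \<alpha> n \<phi> A =
     (let p = (\<lambda>x. measure M {\<omega> \<in> space M. \<phi> x \<omega> \<ge> hp_level TYPE('d) \<alpha> n}) in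
      \<Sum>S\<in>A \<inter> Pow (bulk \<delta> n). (\<Prod>x\<in>S. p x) * (\<Prod>x\<in>bulk \<delta> n - S. 1 - p x))"

text \<open>Total variation distance between the law of H_alpha and nu~_{alpha,n}
  (both measures on subsets of the finite bulk; max over all events).\<close>
definition tv_high :: "'a measure \<Rightarrow> real \<Rightarrow> real \<Rightarrow> nat \<Rightarrow> (int ^ 'd::finite \<Rightarrow> 'a \<Rightarrow> real) \<Rightarrow> real" where
  "tv_high M \<delta> \<alpha> n \<phi> =
     Max ((\<lambda>A. \<bar>measure M {\<omega> \<in> space M. high_points \<delta> \<alpha> n \<phi> \<omega> \<in> A} - bern_law M \<delta> \<alpha> n \<phi> A\<bar>)
          ` Pow (Pow (bulk \<delta> n)))"

end

theory Submission
  imports Defs "HOL-Real_Asymp.Real_Asymp"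
begin

text \<open>Let \<open>Z\<^sub>x\<close> indicate that \<open>x\<close> is a high point. Replacing the \<open>Z\<^sub>x\<close> by independent copies one at a time
  bounds the total variation distance by the sum over \<open>x\<close> of the largest covariance of \<open>Z\<^sub>x\<close> with a function
  of the other indicators bounded by 1. Given the value of the field at \<open>x\<close>, the field is an independent
  residual plus a nonnegative multiple of that value, so \<open>Z\<^sub>x\<close> is positively correlated with every
  increasing function of the high points; this bounds each such covariance by twice the sum of the
  \<open>Cov(Z\<^sub>x, Z\<^sub>y)\<close>.

  For pairs at bounded distance, \<open>Cov(Z\<^sub>x, Z\<^sub>y)\<close> is at most the probability that the sum of the two field
  values exceeds twice the level. A superharmonic function bounds the correlation of distinct points by
  \<open>\<rho> = d / (2 (d - 1))\<close>, so that these pairs contribute \<open>n\<close> to the power \<open>d - 2 \<alpha> d / (1 + \<rho>)\<close>, which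
  is negative exactly under the assumption on \<open>\<alpha>\<close>. For the remaining pairs the covariance is linear in the
  Green's function up to \<open>n\<close> to the power \<open>- 2 \<alpha> d + o(1)\<close>, and the sum of the Green's function over the
  box is at most \<open>d n\<^sup>2\<close>; since \<open>2 \<alpha> d > d + 2\<close>, their contribution vanishes as well.\<close>

subsection \<open>A superharmonic function on the lattice\<close>

text \<open>For \<delta> < 1/2 and \<alpha> < 1 the expected number of distant pairs of high points
  tends to infinity, so at long range a covariance cannot be bounded by the joint probability: the
  product of the marginals must be subtracted, which leaves an error proportional to the Green's
  function. At bounded distance there are only O(n^d) pairs. The short-range condition implies the
  long-range one because d (3 d - 2) - 2 (d - 1) (d + 2) = (d - 2)^2.

  The superharmonic function, evaluated at X - y, is a supermartingale until the walk X reaches y.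
  Hence its ratio to the value at the origin bounds the probability of reaching y, and with it the
  Green's function relative to its value at (y, y).

  A DGFF is given only through the one-dimensional laws of its linear combinations, so no
  independence is at hand. The residuals and the value at x are placed on the two factors of
  \<open>M \<Otimes>\<^sub>M M\<close>, where independence is Fubini, and this model is compared
  with the field through characteristic functions. Only exceedance sets matter, so agreement on
  rectangles suffices.\<close>

lemma lat_adj_iff:
  fixes x z :: "int ^ 'd::finite"
  shows "lat_adj x z \<longleftrightarrow> (\<exists>i. z = x + axis i 1 \<or> z = x - axis i 1)"
proof
  assume "lat_adj x z"
  then have s: "(\<Sum>i\<in>UNIV. \<bar>z $ i - x $ i\<bar>) = 1" by (simp add: lat_adj_def)
  then obtain j where j: "z $ j - x $ j \<noteq> 0"
    by (metis (no_types, lifting) abs_0 sum.neutral zero_neq_one)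
  have split: "\<bar>z $ j - x $ j\<bar> + (\<Sum>i\<in>UNIV - {j}. \<bar>z $ i - x $ i\<bar>) = 1"
    using s by (simp add: sum.remove[of UNIV j])
  have nn: "(\<Sum>i\<in>UNIV - {j}. \<bar>z $ i - x $ i\<bar>) \<ge> 0" by (simp add: sum_nonneg)
  have 1: "\<bar>z $ j - x $ j\<bar> = 1" and 2: "(\<Sum>i\<in>UNIV - {j}. \<bar>z $ i - x $ i\<bar>) = 0"
    using split nn j by linarith+
  have 3: "z $ i = x $ i" if "i \<noteq> j" for i
    using 2 that by (subst (asm) sum_nonneg_eq_0_iff) auto
  have "z $ j - x $ j = 1 \<or> z $ j - x $ j = -1" using 1 by linarith
  then show "\<exists>i. z = x + axis i 1 \<or> z = x - axis i 1"
  proof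
    assume "z $ j - x $ j = 1"
    then have "z = x + axis j 1" using 3 by (auto simp: vec_eq_iff axis_def)
    then show ?thesis by blast
  next
    assume "z $ j - x $ j = -1"
    then have "z = x - axis j 1" using 3 by (auto simp: vec_eq_iff axis_def)
    then show ?thesis by blast
  qed
next
  assume "\<exists>i. z = x + axis i 1 \<or> z = x - axis i 1"
  then obtain i where "z = x + axis i 1 \<or> z = x - axis i 1" by blast
  then have "\<And>k. \<bar>z $ k - x $ k\<bar> = (if k = i then 1 else 0)" by (auto simp: axis_def)
  then show "lat_adj x z" by (simp add: lat_adj_def)
qed

lemma lat_adj_eq_images:
  "{z. lat_adj x z} = range (\<lambda>i. x + axis i 1) \<union> range (\<lambda>i. x - axis i (1::int))"
  by (auto simp: lat_adj_iff)

lemma finite_lat_adj [simp]: "finite {z. lat_adj x z}"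
  by (simp add: lat_adj_eq_images)

lemma sum_lat_adj:
  fixes F :: "int ^ 'd::finite \<Rightarrow> 'b::comm_monoid_add"
  shows "(\<Sum>z | lat_adj x z. F z) = (\<Sum>i\<in>UNIV. F (x + axis i 1) + F (x - axis i 1))"
proof -
  have inj1: "inj (\<lambda>i. x + axis i (1::int))" and inj2: "inj (\<lambda>i. x - axis i (1::int))"
    by (auto simp: inj_on_def axis_eq_axis)
  have disj: "range (\<lambda>i. x + axis i 1) \<inter> range (\<lambda>i. x - axis i (1::int)) = {}"
  proof (rule ccontr)
    assume "range (\<lambda>i. x + axis i 1) \<inter> range (\<lambda>i. x - axis i (1::int)) \<noteq> {}"
    then obtain i j where "x + axis i 1 = x - axis j (1::int)" by auto
    then have "(x + axis i 1) $ i = (x - axis j (1::int)) $ i" by simp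
    then show False by (auto simp: axis_def split: if_splits)
  qed
  show ?thesis
    unfolding lat_adj_eq_images
    by (subst sum.union_disjoint) (auto simp: disj sum.reindex[OF inj1] sum.reindex[OF inj2] sum.distrib)
qed

definition sqnorm :: "int ^ 'd::finite \<Rightarrow> real" where
  "sqnorm x = (\<Sum>i\<in>UNIV. (real_of_int (x $ i))\<^sup>2)"

lemma sqnorm_nonneg: "sqnorm x \<ge> 0"
  by (simp add: sqnorm_def sum_nonneg)

lemma component_le_sqnorm: "(real_of_int (x $ i))\<^sup>2 \<le> sqnorm x"
  unfolding sqnorm_def by (rule member_le_sum) auto

lemma sqnorm_ge_1:
  fixes x :: "int ^ 'd::finite"
  assumes "x \<noteq> 0" shows "sqnorm x \<ge> 1"
proof -
  obtain i where "x $ i \<noteq> 0" using assms by (auto simp: vec_eq_iff)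
  then have "1 \<le> \<bar>real_of_int (x $ i)\<bar>" by linarith
  then have "1 \<le> (real_of_int (x $ i))\<^sup>2" using one_le_power[of "\<bar>real_of_int (x $ i)\<bar>" 2] by simp
  then show ?thesis using component_le_sqnorm[of x i] by linarith
qed

lemma sqnorm_add_axis:
  "sqnorm (x + axis i 1) = sqnorm x + 1 + 2 * real_of_int (x $ i)"
  "sqnorm (x - axis i 1) = sqnorm x + 1 - 2 * real_of_int (x $ i)"
  by (simp_all add: sqnorm_def axis_def sum.remove[of UNIV i] power2_eq_square algebra_simps)

lemma sum_power4_le: "(\<Sum>i\<in>UNIV. (real_of_int (x $ i)) ^ 4) \<le> (sqnorm (x :: int ^ 'd::finite))\<^sup>2"
proof -
  have "(\<Sum>i\<in>UNIV. (real_of_int (x $ i)) ^ 4) \<le> (\<Sum>i\<in>UNIV. (real_of_int (x $ i))\<^sup>2 * sqnorm x)"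
  proof (rule sum_mono)
    fix i
    have "(real_of_int (x $ i))\<^sup>2 * (real_of_int (x $ i))\<^sup>2 \<le> (real_of_int (x $ i))\<^sup>2 * sqnorm x"
      by (intro mult_left_mono component_le_sqnorm) simp
    then show "(real_of_int (x $ i)) ^ 4 \<le> (real_of_int (x $ i))\<^sup>2 * sqnorm x"
      by (simp add: power_def numeral_eq_Suc)
  qed
  also have "\<dots> = (sqnorm x)\<^sup>2" by (simp add: sum_distrib_right[symmetric] power2_eq_square sqnorm_def)
  finally show ?thesis .
qed

section \<open>A polynomial majorant of the inverse square root\<close>

lemma quadratic_nonneg:
  fixes a b c v :: real
  assumes "a > 0" "b\<^sup>2 \<le> 4 * a * c"
  shows "a * v\<^sup>2 + b * v + c \<ge> 0"
proof -
  have "4 * a * (a * v\<^sup>2 + b * v + c) = (2 * a * v + b)\<^sup>2 + (4 * a * c - b\<^sup>2)"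
    by (simp add: power2_eq_square algebra_simps)
  also have "\<dots> \<ge> 0" using assms(2) by simp
  finally show ?thesis using assms(1) by (simp add: zero_le_mult_iff)
qed

text \<open>The cubic part is the Taylor polynomial of (1 + v)^(-1/2). The next Taylor coefficient
  is 35/128; it is raised to 1/2 so that the polynomial also stays above the function for negative v
  down to -2/5.\<close>

lemma inverse_sqrt_le_poly:
  fixes v :: real
  assumes "v \<ge> -2/5"
  shows "1 / sqrt (1 + v) \<le> 1 - v/2 + 3/8 * v^2 - 5/16 * v^3 + v^4 / 2" (is "_ \<le> ?p")
proof -
  \<comment> \<open>\<open>?r\<close> is ((1 + v) ?p^2 - 1) / v^4. The division is exact because
    \<open>?p\<close> agrees with (1 + v)^(-1/2) up to order three.\<close>
  let ?r = "29/64 + 23/32 * v - 67/256 * v^2 + 41/256 * v^3 - 1/16 * v^4 + 1/4 * v^5"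
  have "?p \<ge> 0 \<and> ?r \<ge> 0"
  proof (cases "v \<ge> 0")
    case True
    \<comment> \<open>Up to a positive constant, both polynomials split into blocks that are a power
      of v times a quadratic with negative discriminant.\<close>
    have "1/8 * v\<^sup>2 + (-1/2) * v + 1 \<ge> 0" by (rule quadratic_nonneg) (auto simp: power2_eq_square)
    moreover have "v\<^sup>2 * (1/2 * v\<^sup>2 + (-5/16) * v + 1/4) \<ge> 0"
      by (intro mult_nonneg_nonneg quadratic_nonneg) (auto simp: power2_eq_square)
    moreover have "v * (25/256 * v\<^sup>2 + (-67/256) * v + 23/32) \<ge> 0"
      using True by (intro mult_nonneg_nonneg quadratic_nonneg) (auto simp: power2_eq_square)
    moreover have "v^3 * (1/4 * v\<^sup>2 + (-1/16) * v + 1/16) \<ge> 0"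
      using True by (intro mult_nonneg_nonneg quadratic_nonneg) (auto simp: power2_eq_square)
    ultimately show ?thesis
      by (auto simp: algebra_simps numeral_eq_Suc)
  next
    case False
    \<comment> \<open>In terms of w all coefficients of \<open>?p\<close> are positive and all
      nonconstant ones of \<open>?r\<close> are negative, so \<open>?r\<close> is smallest at w =
      2/5.\<close>
    define w where "w = - v"
    have w: "0 \<le> w" "w \<le> 2/5" using False assms by (auto simp: w_def)
    have pw: "w^2 \<le> (2/5)^2" "w^3 \<le> (2/5)^3" "w^4 \<le> (2/5)^4" "w^5 \<le> (2/5)^5"
      using w by (intro power_mono; simp)+
    have pn: "0 \<le> w^2" "0 \<le> w^3" "0 \<le> w^4" using w by simp_all
    have v: "v = - w" by (simp add: w_def)
    show ?thesis using w pw pn unfolding v by (simp add: power_divide)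
  qed
  then have p0: "?p \<ge> 0" and r0: "?r \<ge> 0" by auto
  have "(1 + v) * ?p\<^sup>2 = 1 + v^4 * ?r"
    by (simp add: field_simps numeral_eq_Suc)
  with r0 have "1 \<le> (1 + v) * ?p\<^sup>2" by simp
  then have "1 \<le> sqrt ((1 + v) * ?p\<^sup>2)" by simp
  also have "\<dots> = sqrt (1 + v) * ?p" using p0 by (simp add: real_sqrt_mult)
  finally show ?thesis using assms by (simp add: field_simps)
qed

text \<open>With y the i-th coordinate of x, the shifted squared norms of the two neighbours in
  direction i are R + 1 + 2 y and R + 1 - 2 y. The polynomial bound is applied at (1 + 2 y) / R and
  (1 - 2 y) / R, and adding the two cancels the odd powers of y. Summation over i then needs only
  that the y^2 add up to b and the y^4 to at most b^2.\<close>

lemma sum_shifted_inverse_sqrt_le: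
  fixes x :: "int ^ 'd::finite"
  defines "b \<equiv> sqnorm x" and "R \<equiv> sqnorm x + 4" and "d \<equiv> real CARD('d)"
  shows "(\<Sum>i\<in>UNIV. 1 / sqrt (sqnorm (x + axis i 1) + 4) + 1 / sqrt (sqnorm (x - axis i 1) + 4))
     \<le> (1 / sqrt R) * (2 * d - d / R + 3/4 * (d + 4 * b) / R^2 - 5/8 * (d + 12 * b) / R^3
         + (d + 24 * b + 16 * b\<^sup>2) / R^4)"
proof -
  have R: "R > 0" using sqnorm_nonneg[of x] by (simp add: R_def)
  have key: "1 / sqrt (R + 1 + 2 * y) + 1 / sqrt (R + 1 - 2 * y) \<le>
      (1 / sqrt R) * (2 - 1 / R + 3/4 * (1 + 4 * y\<^sup>2) / R^2 - 5/8 * (1 + 12 * y\<^sup>2) / R^3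
         + (1 + 24 * y\<^sup>2 + 16 * y^4) / R^4)" if y: "y\<^sup>2 + 4 \<le> R" for y
  proof -
    let ?p = "\<lambda>v::real. 1 - v/2 + 3/8 * v^2 - 5/16 * v^3 + v^4 / 2"
    have one: "1 / sqrt (R + 1 + 2 * z) \<le> (1 / sqrt R) * ?p ((1 + 2 * z) / R)" if z: "z\<^sup>2 + 4 \<le> R" for z
    proof -
      \<comment> \<open>The discriminant is 25 - 26: the shift by 4 is large enough to keep the
        argument of the polynomial above -2/5.\<close>
      have "1 * z\<^sup>2 + 5 * z + 13/2 \<ge> 0" by (rule quadratic_nonneg) auto
      then have "(1 + 2 * z) / R \<ge> -2/5" using z R by (simp add: field_simps)
      then have *: "1 / sqrt (1 + (1 + 2 * z) / R) \<le> ?p ((1 + 2 * z) / R)" by (rule inverse_sqrt_le_poly)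
      have "R + 1 + 2 * z = R * (1 + (1 + 2 * z) / R)" using R by (simp add: field_simps)
      then have "1 / sqrt (R + 1 + 2 * z) = (1 / sqrt R) * (1 / sqrt (1 + (1 + 2 * z) / R))"
        by (simp add: real_sqrt_mult)
      also have "\<dots> \<le> (1 / sqrt R) * ?p ((1 + 2 * z) / R)" using * R by (intro mult_left_mono) auto
      finally show ?thesis .
    qed
    have "1 / sqrt (R + 1 + 2 * y) + 1 / sqrt (R + 1 - 2 * y)
        \<le> (1 / sqrt R) * (?p ((1 + 2 * y) / R) + ?p ((1 + 2 * (-y)) / R))"
    proof -
      have "R + 1 - 2 * y = R + 1 + 2 * (- y)" by simp
      then show ?thesis
        using add_mono[OF one[OF y] one[of "-y"]] y by (simp only: distrib_left power2_minus)
    qed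
    also have "?p ((1 + 2 * y) / R) + ?p ((1 + 2 * (-y)) / R) =
       2 - 1 / R + 3/4 * (1 + 4 * y\<^sup>2) / R^2 - 5/8 * (1 + 12 * y\<^sup>2) / R^3
         + (1 + 24 * y\<^sup>2 + 16 * y^4) / R^4"
      using R by (simp add: power_divide field_simps power2_eq_square power3_eq_cube power4_eq_xxxx)
    finally show ?thesis .
  qed
  have "(\<Sum>i\<in>UNIV. 1 / sqrt (sqnorm (x + axis i 1) + 4) + 1 / sqrt (sqnorm (x - axis i 1) + 4))
     \<le> (\<Sum>i\<in>UNIV. (1 / sqrt R) * (2 - 1 / R + 3/4 * (1 + 4 * (real_of_int (x $ i))\<^sup>2) / R^2
         - 5/8 * (1 + 12 * (real_of_int (x $ i))\<^sup>2) / R^3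
         + (1 + 24 * (real_of_int (x $ i))\<^sup>2 + 16 * (real_of_int (x $ i))^4) / R^4))"
  proof (rule sum_mono)
    fix i
    have "(real_of_int (x $ i))\<^sup>2 + 4 \<le> R" using component_le_sqnorm[of x i] by (simp add: R_def)
    from key[OF this] show "1 / sqrt (sqnorm (x + axis i 1) + 4) + 1 / sqrt (sqnorm (x - axis i 1) + 4) \<le>
      (1 / sqrt R) * (2 - 1 / R + 3/4 * (1 + 4 * (real_of_int (x $ i))\<^sup>2) / R^2
         - 5/8 * (1 + 12 * (real_of_int (x $ i))\<^sup>2) / R^3
         + (1 + 24 * (real_of_int (x $ i))\<^sup>2 + 16 * (real_of_int (x $ i))^4) / R^4)"
      by (simp add: sqnorm_add_axis R_def algebra_simps)
  qed
  also have "\<dots> = (1 / sqrt R) * (2 * d - d / R + 3/4 * (d + 4 * b) / R^2 - 5/8 * (d + 12 * b) / R^3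
         + (d + 24 * b + 16 * (\<Sum>i\<in>UNIV. (real_of_int (x $ i))^4)) / R^4)"
    unfolding d_def b_def sqnorm_def
    by (simp add: sum_distrib_left[symmetric] sum.distrib sum_subtractf sum_divide_distrib[symmetric])
      (simp add: algebra_simps)
  also have "\<dots> \<le> (1 / sqrt R) * (2 * d - d / R + 3/4 * (d + 4 * b) / R^2 - 5/8 * (d + 12 * b) / R^3
         + (d + 24 * b + 16 * b\<^sup>2) / R^4)"
    using sum_power4_le[of x] R unfolding b_def
    by (intro mult_left_mono add_left_mono divide_right_mono) auto
  finally show ?thesis .
qed

text \<open>The exponent is that of the Green's function in dimension 3; the shift by 4 makes the function
  superharmonic on the lattice. The value at the origin is chosen as large as needed for the ratio between
  neighbours and origin to be d / (2 (d - 1)): with this correlation bound the first-moment condition for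
  pairs of neighbouring high points is exactly the assumption on \<open>\<alpha>\<close>.\<close>

definition lyap :: "int ^ 'd::finite \<Rightarrow> real" where
  "lyap x = (if x = 0 then 2 * (real CARD('d) - 1) / real CARD('d) / sqrt 5 else 1 / sqrt (sqnorm x + 4))"

text \<open>In units of 1 / sqrt R, \<open>E\<close> bounds the excess of the neighbour sum of
  \<open>F\<close> over the superharmonic value 2 d. It is negative, which is enough unless the
  origin is a neighbour of x. In that case its size pays for raising the value at the origin from
  \<open>F 0\<close> to \<open>lyap 0\<close>.\<close>

lemma lyap_superharmonic:
  fixes x :: "int ^ 'd::finite"
  assumes d3: "CARD('d) \<ge> 3" and x: "x \<noteq> 0"
  shows "(\<Sum>z | lat_adj x z. lyap z) \<le> 2 * real CARD('d) * lyap x"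
proof -
  define d where "d = real CARD('d)"
  have d: "d \<ge> 3" using d3 by (simp add: d_def)
  define F where "F = (\<lambda>z::int^'d. 1 / sqrt (sqnorm z + 4))"
  define b R where "b = sqnorm x" and "R = sqnorm x + 4"
  define E where "E = - d / R + 3/4 * (d + 4 * b) / R^2 - 5/8 * (d + 12 * b) / R^3
         + (d + 24 * b + 16 * b\<^sup>2) / R^4"
  have R: "R \<ge> 5" using sqnorm_ge_1[OF x] by (simp add: R_def)
  have b: "b = R - 4" by (simp add: b_def R_def)
  have lx: "lyap x = 1 / sqrt R" using x by (simp add: lyap_def R_def)
  have sumF: "(\<Sum>z | lat_adj x z. F z) \<le> (1 / sqrt R) * (2 * d + E)"
    using sum_shifted_inverse_sqrt_le[of x]
    unfolding sum_lat_adj F_def E_def b_def R_def d_def by (simp add: algebra_simps)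
  show ?thesis
  proof (cases "lat_adj x 0")
    case False
    have "(\<Sum>z | lat_adj x z. lyap z) = (\<Sum>z | lat_adj x z. F z)"
      using False by (intro sum.cong) (auto simp: lyap_def F_def)
    moreover have "E \<le> 0"
    proof -
      have "R^3 * E * R = - d * R^3 + 3/4 * (d + 4 * b) * R^2 - 5/8 * (d + 12 * b) * R + (d + 24 * b + 16 * b\<^sup>2)"
        using R by (simp add: E_def field_simps power2_eq_square power3_eq_cube power4_eq_xxxx)
      \<comment> \<open>Expansion around d = 3: there the cubic terms cancel, as 1 / |x| is harmonic
        in three dimensions, and the lower-order terms decide the sign.\<close>
      also have "\<dots> = - ((d - 3) * (R^3 - 3/4 * R^2 + 5/8 * R - 1)) - (5/4 * R^2 + 607/8 * R - 163)"
        unfolding b by (simp add: field_simps power2_eq_square power3_eq_cube)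
      also have "\<dots> \<le> 0"
      proof -
        have 1: "R * R \<ge> 5 * R" using R by (intro mult_right_mono) auto
        moreover have "R * R * R \<ge> 5 * R * R" using R by (intro mult_right_mono) auto
        ultimately have "R^3 - 3/4 * R^2 + 5/8 * R - 1 \<ge> 0" "5/4 * R^2 + 607/8 * R - 163 \<ge> 0"
          using R unfolding power2_eq_square power3_eq_cube by linarith+
        moreover from this have "(d - 3) * (R^3 - 3/4 * R^2 + 5/8 * R - 1) \<ge> 0"
          using d by (intro mult_nonneg_nonneg) auto
        ultimately show ?thesis by linarith
      qed
      finally show ?thesis using R by (simp add: mult_le_0_iff zero_le_mult_iff)
    qed
    then have "(1 / sqrt R) * (2 * d + E) \<le> (1 / sqrt R) * (2 * d)" using R by (intro mult_left_mono) auto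
    ultimately show ?thesis using sumF lx by (simp add: d_def)
  next
    case True
    then obtain i where "0 = x + axis i 1 \<or> 0 = x - axis i 1" by (auto simp: lat_adj_iff)
    then have "x = - axis i 1 \<or> x = axis i 1"
      by (metis add.inverse_inverse add_eq_0_iff eq_iff_diff_eq_0)
    then have b1: "b = 1" by (auto simp: b_def sqnorm_def axis_def sum.remove[of UNIV i])
    then have R5: "R = 5" using b by simp
    have E: "E = (77.5 - 108.375 * d) / 625" unfolding E_def R5 b1 by (simp add: field_simps)
    have s5: "sqrt 5 \<ge> 2.236" by (rule real_le_rsqrt) (simp add: power2_eq_square)
    have "(\<Sum>z | lat_adj x z. lyap z) = lyap (0 :: int ^ 'd) - F 0 + (\<Sum>z | lat_adj x z. F z)"
    proof -
      have "(\<Sum>z | lat_adj x z. lyap z) = lyap (0 :: int ^ 'd) + (\<Sum>z\<in>{z. lat_adj x z} - {0}. lyap z)"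
        using True by (simp add: sum.remove[of "{z. lat_adj x z}" 0])
      also have "(\<Sum>z\<in>{z. lat_adj x z} - {0}. lyap z) = (\<Sum>z\<in>{z. lat_adj x z} - {0}. F z)"
        by (intro sum.cong) (auto simp: lyap_def F_def)
      also have "\<dots> = (\<Sum>z | lat_adj x z. F z) - F 0"
        using True by (subst sum.remove[of "{z. lat_adj x z}" 0]) auto
      finally show ?thesis by simp
    qed
    moreover have "lyap (0 :: int^'d) - F 0 \<le> (1 / sqrt R) * (- E)"
    proof -
      have F0: "F 0 = (1 / sqrt 5) * (sqrt 5 / 2)" by (simp add: F_def sqnorm_def)
      have "lyap (0 :: int^'d) - F 0 = (1 / sqrt 5) * (2 * (d - 1) / d - sqrt 5 / 2)"
        unfolding F0 right_diff_distrib[of "1 / sqrt 5"] by (simp add: lyap_def d_def)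
      also have "2 * (d - 1) / d - sqrt 5 / 2 \<le> 2 * (d - 1) / d - 1.118" using s5 by simp
      also have "2 * (d - 1) / d - 1.118 \<le> - E"
      proof -
        \<comment> \<open>The claim multiplied by d: 0.1734 = 108.375 / 625 and 1.006 = 2 - 1.118 +
          77.5 / 625.\<close>
        have "0.1734 * d\<^sup>2 + (-1.006) * d + 2 \<ge> 0" by (rule quadratic_nonneg) (auto simp: power2_eq_square)
        then show ?thesis using d unfolding E by (simp add: field_simps power2_eq_square)
      qed
      finally show ?thesis unfolding R5 by (simp add: divide_right_mono)
    qed
    ultimately have "(\<Sum>z | lat_adj x z. lyap z) \<le> (1 / sqrt R) * (2 * d + E) + (1 / sqrt R) * (- E)"
      using sumF by linarith
    then show ?thesis using lx by (simp add: d_def add_divide_distrib)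
  qed
qed


text \<open>This is \<open>lyap\<close> at a unit vector divided by \<open>lyap 0\<close>: a bound
  for the probability that the walk ever hits a given point other than its start.\<close>

definition hit_ratio :: "'d::finite itself \<Rightarrow> real" where
  "hit_ratio _ = real CARD('d) / (2 * (real CARD('d) - 1))"

lemma hit_ratio_bounds:
  assumes "CARD('d::finite) \<ge> 3"
  shows "0 < hit_ratio TYPE('d)" "hit_ratio TYPE('d) < 1"
  using assms by (auto simp: hit_ratio_def)

lemma lyap_pos:
  assumes "CARD('d::finite) \<ge> 3"
  shows "lyap (x :: int ^ 'd) > 0"
  using assms sqnorm_nonneg[of x] by (auto simp: lyap_def intro!: divide_pos_pos)

lemma hit_ratio_lyap_0:
  assumes "CARD('d::finite) \<ge> 3"
  shows "hit_ratio TYPE('d) * lyap (0 :: int ^ 'd) = 1 / sqrt 5"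
  using assms by (auto simp: hit_ratio_def lyap_def field_simps)

lemma lyap_le_hit_ratio:
  assumes "CARD('d::finite) \<ge> 3" and "x \<noteq> 0"
  shows "lyap (x :: int ^ 'd) \<le> hit_ratio TYPE('d) * lyap (0 :: int ^ 'd)"
  unfolding hit_ratio_lyap_0[OF assms(1)]
  using assms sqnorm_ge_1[OF assms(2)] by (auto simp: lyap_def frac_le)

text \<open>At the origin \<open>lyap\<close> exceeds its average over the neighbours by
  \<open>1 - hit_ratio\<close> times \<open>lyap 0\<close>. Dividing by this constant turns
  \<open>lyap\<close> into a majorant of the Green's function.\<close>

lemma sum_lat_adj_lyap_0:
  assumes "CARD('d::finite) \<ge> 3"
  shows "(\<Sum>z | lat_adj (0 :: int ^ 'd) z. lyap z)
      = 2 * real CARD('d) * (hit_ratio TYPE('d) * lyap (0 :: int ^ 'd))"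
proof -
  have "sqnorm (axis i 1 :: int ^ 'd) = 1" "sqnorm (- axis i 1 :: int ^ 'd) = 1" for i
    by (auto simp: sqnorm_def axis_def sum.remove[of UNIV i])
  then have "lyap (axis i 1 :: int ^ 'd) = 1 / sqrt 5" "lyap (- axis i 1 :: int ^ 'd) = 1 / sqrt 5" for i
    by (simp_all add: lyap_def)
  then show ?thesis by (simp add: sum_lat_adj hit_ratio_lyap_0[OF assms])
qed

lemma sum_lat_adj_shift:
  fixes F :: "int ^ 'd::finite \<Rightarrow> 'b::comm_monoid_add"
  shows "(\<Sum>z | lat_adj x z. F (z - y)) = (\<Sum>z | lat_adj (x - y) z. F z)"
  by (simp add: sum_lat_adj algebra_simps)

subsection \<open>Bounds for the Green's function of the box\<close>

lemma zd_step_nonneg: "zd_step k x y \<ge> 0"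
  by (induction k arbitrary: x) (auto intro!: sum_nonneg)

lemma kill_step_nonneg: "kill_step n k x y \<ge> 0"
  by (induction k arbitrary: x) (auto intro!: sum_nonneg)

lemma kill_step_le_zd_step: "kill_step n k x y \<le> zd_step k x y"
proof (induction k arbitrary: x)
  case (Suc k)
  have "kill_step n (Suc k) x y \<le> (\<Sum>z\<in>{z \<in> box_int n. lat_adj x z}. zd_step k z y / (2 * real CARD('a)))"
    by (auto intro!: sum_mono divide_right_mono Suc)
  also have "\<dots> \<le> zd_step (Suc k) x y"
    by (auto intro!: sum_mono2 simp: zd_step_nonneg)
  finally show ?case .
qed auto

lemma zd_step_translate: "zd_step k x y = zd_step k (x - y) 0"
proof (induction k arbitrary: x)
  case (Suc k)
  have "zd_step (Suc k) x y = (\<Sum>z | lat_adj x z. zd_step k (z - y) 0 / (2 * real CARD('a)))"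
    by (simp, subst Suc) simp
  also have "\<dots> = zd_step (Suc k) (x - y) 0"
    using sum_lat_adj_shift[where F = "\<lambda>z. zd_step k z 0 / (2 * real CARD('a))"] by simp
  finally show ?case .
qed auto

text \<open>With P the one-step average, \<open>lyap (x - y) / ?c\<close> as a function of x is a
  supersolution of f = 1_y + P f: off y by superharmonicity, at y with equality by the choice of
  \<open>?c\<close>. The partial sums start below it and stay there, which gives transience and
  decay at once.\<close>

lemma sum_zd_step_le:
  fixes x y :: "int ^ 'd::finite"
  assumes d3: "CARD('d) \<ge> 3"
  shows "(\<Sum>k<K. zd_step k x y) \<le> lyap (x - y) / ((1 - hit_ratio TYPE('d)) * lyap (0 :: int ^ 'd))"
    (is "_ \<le> _ / ?c")
proof (induction K arbitrary: x)
  case 0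
  then show ?case using lyap_pos[OF d3, of "x - y"] lyap_pos[OF d3, of 0] hit_ratio_bounds[OF d3] by simp
next
  case (Suc K)
  have c: "?c > 0" using lyap_pos[OF d3, of 0] hit_ratio_bounds[OF d3] by simp
  have "(\<Sum>k<Suc K. zd_step k x y) = (if x = y then 1 else 0) + (\<Sum>k<K. zd_step (Suc k) x y)"
    by (subst sum.lessThan_Suc_shift) simp
  also have "(\<Sum>k<K. zd_step (Suc k) x y) = (\<Sum>z | lat_adj x z. (\<Sum>k<K. zd_step k z y)) / (2 * real CARD('d))"
    by (simp add: sum.swap[of _ "{..<K}"] sum_divide_distrib)
  also have "(\<Sum>z | lat_adj x z. (\<Sum>k<K. zd_step k z y)) \<le> (\<Sum>z | lat_adj x z. lyap (z - y) / ?c)"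
    by (intro sum_mono Suc)
  also have "\<dots> = (\<Sum>z | lat_adj (x - y) z. lyap z) / ?c"
    by (simp add: sum_lat_adj_shift[symmetric] sum_divide_distrib)
  finally have *: "(\<Sum>k<Suc K. zd_step k x y)
      \<le> (if x = y then 1 else 0) + (\<Sum>z | lat_adj (x - y) z. lyap z) / ?c / (2 * real CARD('d))"
    by (simp add: divide_right_mono)
  show ?case
  proof (cases "x = y")
    case True
    have "1 + (\<Sum>z | lat_adj (0 :: int ^ 'd) z. lyap z) / ?c / (2 * real CARD('d)) = lyap (0 :: int ^ 'd) / ?c"
    proof -
      have "1 + (\<Sum>z | lat_adj (0 :: int ^ 'd) z. lyap z) / ?c / (2 * real CARD('d))
          = (?c + hit_ratio TYPE('d) * lyap (0 :: int ^ 'd)) / ?c"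
        unfolding sum_lat_adj_lyap_0[OF d3] using lyap_pos[OF d3, of 0] hit_ratio_bounds[OF d3]
        by (simp add: add_divide_distrib)
      then show ?thesis by (simp add: algebra_simps)
    qed
    then show ?thesis using * True by simp
  next
    case False
    have "(\<Sum>z | lat_adj (x - y) z. lyap z) / ?c / (2 * real CARD('d)) \<le>
        (2 * real CARD('d) * lyap (x - y)) / ?c / (2 * real CARD('d))"
      using c False by (intro divide_right_mono lyap_superharmonic d3) auto
    also have "\<dots> = lyap (x - y) / ?c" by simp
    finally show ?thesis using * False by simp
  qed
qed

lemma summable_zd_step:
  fixes x y :: "int ^ 'd::finite"
  assumes d3: "CARD('d) \<ge> 3"
  shows "summable (\<lambda>k. zd_step k x y)"
  by (rule summableI_nonneg_bounded[OF zd_step_nonneg sum_zd_step_le[OF d3]])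

lemma summable_kill_step:
  fixes x y :: "int ^ 'd::finite"
  assumes d3: "CARD('d) \<ge> 3"
  shows "summable (\<lambda>k. kill_step n k x y)"
  by (rule summable_comparison_test'[OF summable_zd_step[OF d3, of x y]])
    (simp add: kill_step_nonneg kill_step_le_zd_step)

lemma green_box_nonneg:
  fixes x y :: "int ^ 'd::finite"
  assumes d3: "CARD('d) \<ge> 3"
  shows "green_box n x y \<ge> 0"
  unfolding green_box_def by (intro suminf_nonneg summable_kill_step d3 kill_step_nonneg)

lemma green_box_diag_ge_1:
  fixes x :: "int ^ 'd::finite"
  assumes d3: "CARD('d) \<ge> 3"
  shows "green_box n x x \<ge> 1"
  using sum_le_suminf[OF summable_kill_step[OF d3, of n x x], of "{0}"]
  by (simp add: green_box_def kill_step_nonneg)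

lemma green_box_diag_le_green0:
  fixes x :: "int ^ 'd::finite"
  assumes d3: "CARD('d) \<ge> 3"
  shows "green_box n x x \<le> green0 TYPE('d)"
proof -
  have "green_box n x x \<le> (\<Sum>k. zd_step k x x)"
    unfolding green_box_def by (intro suminf_le kill_step_le_zd_step summable_kill_step summable_zd_step d3)
  also have "\<dots> = green0 TYPE('d)"
    unfolding green0_def by (subst zd_step_translate) simp
  finally show ?thesis .
qed

lemma green_box_le_lyap:
  fixes x y :: "int ^ 'd::finite"
  assumes d3: "CARD('d) \<ge> 3"
  shows "green_box n x y \<le> lyap (x - y) / ((1 - hit_ratio TYPE('d)) * lyap (0 :: int ^ 'd))"
proof -
  have "green_box n x y \<le> (\<Sum>k. zd_step k x y)"
    unfolding green_box_def by (intro suminf_le kill_step_le_zd_step summable_kill_step summable_zd_step d3)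
  also have "\<dots> \<le> lyap (x - y) / ((1 - hit_ratio TYPE('d)) * lyap (0 :: int ^ 'd))"
    by (intro suminf_le_const summable_zd_step sum_zd_step_le d3)
  finally show ?thesis .
qed

text \<open>This is the factorisation of the Green's function into a hitting probability and its
  value at (y, y), as an inequality and without hitting times: \<open>m * lyap (x - y)\<close>
  dominates the partial sums by induction on the number of steps. At x = y the full Green's function
  is the bound; elsewhere superharmonicity carries the induction.\<close>

lemma green_box_le_hit_ratio:
  fixes x y :: "int ^ 'd::finite"
  assumes d3: "CARD('d) \<ge> 3" and xy: "x \<noteq> y"
  shows "green_box n x y \<le> hit_ratio TYPE('d) * green_box n y y"
proof -
  define m where "m = green_box n y y / lyap (0 :: int ^ 'd)"
  have m: "m \<ge> 0" using green_box_nonneg[OF d3] lyap_pos[OF d3, of 0] by (simp add: m_def)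
  have "(\<Sum>k<K. kill_step n k x y) \<le> m * lyap (x - y)" for K
  proof (induction K arbitrary: x)
    case 0
    then show ?case using m lyap_pos[OF d3, of "x - y"] by simp
  next
    case (Suc K)
    show ?case
    proof (cases "x = y")
      case True
      have "(\<Sum>k<Suc K. kill_step n k y y) \<le> green_box n y y"
        unfolding green_box_def
        by (intro sum_le_suminf summable_kill_step d3) (auto simp: kill_step_nonneg simp del: kill_step.simps)
      then show ?thesis using True lyap_pos[OF d3, of 0] by (simp add: m_def)
    next
      case False
      have "(\<Sum>k<Suc K. kill_step n k x y) = (\<Sum>k<K. kill_step n (Suc k) x y)"
        using False by (subst sum.lessThan_Suc_shift) simp
      also have "\<dots> = (\<Sum>z\<in>{z \<in> box_int n. lat_adj x z}. (\<Sum>k<K. kill_step n k z y)) / (2 * real CARD('d))"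
        by (simp add: sum.swap[of _ "{..<K}"] sum_divide_distrib)
      also have "\<dots> \<le> (\<Sum>z\<in>{z \<in> box_int n. lat_adj x z}. m * lyap (z - y)) / (2 * real CARD('d))"
        by (intro divide_right_mono sum_mono Suc) auto
      \<comment> \<open>Neighbours outside the box may be added because \<open>lyap\<close> is
        positive.\<close>
      also have "\<dots> \<le> (\<Sum>z | lat_adj x z. m * lyap (z - y)) / (2 * real CARD('d))"
        using m lyap_pos[OF d3] by (intro divide_right_mono sum_mono2) (auto simp: less_imp_le)
      also have "\<dots> = m * (\<Sum>z | lat_adj (x - y) z. lyap z) / (2 * real CARD('d))"
        by (simp add: sum_lat_adj_shift[symmetric] sum_distrib_left)
      also have "\<dots> \<le> m * (2 * real CARD('d) * lyap (x - y)) / (2 * real CARD('d))"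
        using m False by (intro divide_right_mono mult_left_mono lyap_superharmonic d3) auto
      finally show ?thesis by simp
    qed
  qed
  then have "green_box n x y \<le> m * lyap (x - y)"
    unfolding green_box_def by (intro suminf_le_const summable_kill_step d3)
  also have "\<dots> \<le> m * (hit_ratio TYPE('d) * lyap (0 :: int ^ 'd))"
    using m xy by (intro mult_left_mono lyap_le_hit_ratio d3) auto
  also have "\<dots> = hit_ratio TYPE('d) * green_box n y y" using lyap_pos[OF d3, of 0] by (simp add: m_def)
  finally show ?thesis .
qed

lemma card_vec_box_le:
  fixes S :: "'d::finite \<Rightarrow> int set"
  assumes "\<And>i. finite (S i)"
  shows "finite {x :: int ^ 'd. \<forall>i. x $ i \<in> S i}" "card {x :: int ^ 'd. \<forall>i. x $ i \<in> S i} \<le> (\<Prod>i\<in>UNIV. card (S i))"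
proof -
  have sub: "{x :: int ^ 'd. \<forall>i. x $ i \<in> S i} \<subseteq> (\<lambda>f. \<chi> i. f i) ` (PiE UNIV S)"
  proof
    fix x :: "int ^ 'd" assume "x \<in> {x. \<forall>i. x $ i \<in> S i}"
    then have "(\<lambda>i. x $ i) \<in> PiE UNIV S" by auto
    moreover have "x = (\<chi> i. x $ i)" by simp
    ultimately show "x \<in> (\<lambda>f. \<chi> i. f i) ` (PiE UNIV S)" by blast
  qed
  have fin: "finite (PiE UNIV S)" using assms by (intro finite_PiE) auto
  show "finite {x :: int ^ 'd. \<forall>i. x $ i \<in> S i}" using sub fin finite_surj by blast
  have "card {x :: int ^ 'd. \<forall>i. x $ i \<in> S i} \<le> card (PiE UNIV S)"
    using surj_card_le[OF fin sub] .
  then show "card {x :: int ^ 'd. \<forall>i. x $ i \<in> S i} \<le> (\<Prod>i\<in>UNIV. card (S i))"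
    by (simp add: card_PiE)
qed

lemma finite_box_int [simp]: "finite (box_int n :: (int ^ 'd::finite) set)"
  using card_vec_box_le(1)[of "\<lambda>_::'d. {0<..<int n}"] by (simp add: box_int_def)

text \<open>The sum is the expected exit time from the box, at most that from a slab in an arbitrary
  direction j. For the slab, \<open>e\<close> is the exact solution: t (n - t) has second difference
  -2 and only one of the d directions sees it, so the factor d makes the neighbour average equal to
  \<open>e x - 1\<close>.\<close>

lemma sum_green_box_le:
  fixes x :: "int ^ 'd::finite"
  assumes d3: "CARD('d) \<ge> 3" and x: "x \<in> box_int n"
  shows "(\<Sum>y\<in>box_int n. green_box n x y) \<le> real CARD('d) * (real n)\<^sup>2"
proof -
  define j :: 'd where "j = undefined"
  define e :: "int ^ 'd \<Rightarrow> real" where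
    "e = (\<lambda>z. real CARD('d) * (real_of_int (z $ j) * (real n - real_of_int (z $ j))))"
  have "(\<Sum>k<K. \<Sum>y\<in>box_int n. kill_step n k x y) \<le> e x" for K
    using x
  proof (induction K arbitrary: x)
    case 0
    then have "0 < x $ j" "x $ j < int n" by (auto simp: box_int_def)
    then show ?case by (auto simp: e_def less_imp_le intro!: mult_nonneg_nonneg)
  next
    case (Suc K)
    have xj: "0 < x $ j" "x $ j < int n" using Suc.prems by (auto simp: box_int_def)
    \<comment> \<open>A neighbour may lie on the boundary; \<open>e\<close> is still nonnegative
      there, so the sum may be extended to all neighbours.\<close>
    have e_nn: "e z \<ge> 0" if "lat_adj x z" for z
    proof -
      obtain i where "z = x + axis i 1 \<or> z = x - axis i 1" using \<open>lat_adj x z\<close> by (auto simp: lat_adj_iff)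
      then have "0 \<le> z $ j" "z $ j \<le> int n" using xj by (auto simp: axis_def split: if_splits)
      then show ?thesis by (auto simp: e_def intro!: mult_nonneg_nonneg)
    qed
    have "(\<Sum>k<Suc K. \<Sum>y\<in>box_int n. kill_step n k x y)
        = 1 + (\<Sum>k<K. \<Sum>y\<in>box_int n. kill_step n (Suc k) x y)"
      using Suc.prems by (subst sum.lessThan_Suc_shift) simp
    also have "(\<Sum>k<K. \<Sum>y\<in>box_int n. kill_step n (Suc k) x y)
        = (\<Sum>z\<in>{z \<in> box_int n. lat_adj x z}. (\<Sum>k<K. \<Sum>y\<in>box_int n. kill_step n k z y)) / (2 * real CARD('d))"
      by (simp add: sum.swap[of _ "{z \<in> box_int n. lat_adj x z}"] sum_divide_distrib)
    also have "\<dots> \<le> (\<Sum>z\<in>{z \<in> box_int n. lat_adj x z}. e z) / (2 * real CARD('d))"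
      by (intro divide_right_mono sum_mono Suc.IH) auto
    also have "\<dots> \<le> (\<Sum>z | lat_adj x z. e z) / (2 * real CARD('d))"
      using e_nn by (intro divide_right_mono sum_mono2) auto
    also have "(\<Sum>z | lat_adj x z. e z) = (\<Sum>i\<in>UNIV. 2 * e x - (if i = j then 2 * real CARD('d) else 0))"
      unfolding sum_lat_adj by (intro sum.cong) (auto simp: e_def axis_def algebra_simps)
    also have "\<dots> = 2 * real CARD('d) * (e x - 1)"
      by (simp add: sum_subtractf algebra_simps)
    finally show ?case by simp
  qed
  then have "(\<Sum>k. \<Sum>y\<in>box_int n. kill_step n k x y) \<le> e x"
    by (intro suminf_le_const summable_sum summable_kill_step d3)
  moreover have "(\<Sum>k. \<Sum>y\<in>box_int n. kill_step n k x y) = (\<Sum>y\<in>box_int n. green_box n x y)"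
    unfolding green_box_def by (intro suminf_sum summable_kill_step d3)
  moreover have "e x \<le> real CARD('d) * (real n)\<^sup>2"
  proof -
    have "0 < x $ j" "x $ j < int n" using x by (auto simp: box_int_def)
    then show ?thesis unfolding e_def power2_eq_square by (intro mult_left_mono mult_mono) auto
  qed
  ultimately show ?thesis by simp
qed

text \<open>The estimate comes from the walk on the whole lattice, so \<open>r\<close> does not
  depend on n and every point has a bounded number of near partners.\<close>

lemma green_box_le_far:
  fixes \<epsilon> :: real
  assumes d3: "CARD('d::finite) \<ge> 3" and "\<epsilon> > 0"
  obtains r :: nat where "\<And>n (x :: int ^ 'd) y. \<exists>i. \<bar>x $ i - y $ i\<bar> > int r \<Longrightarrow> green_box n x y \<le> \<epsilon>"
proof -
  define c where "c = (1 - hit_ratio TYPE('d)) * lyap (0 :: int ^ 'd)"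
  have c: "c > 0" using lyap_pos[OF d3, of 0] hit_ratio_bounds[OF d3] by (simp add: c_def)
  obtain r :: nat where r: "real r > 1 / (\<epsilon> * c)" using reals_Archimedean2 by blast
  have r0: "0 < real r" using r c assms(2) by (meson divide_pos_pos less_trans mult_pos_pos zero_less_one)
  have "green_box n x y \<le> \<epsilon>" if far: "\<exists>i. \<bar>x $ i - y $ i\<bar> > int r" for n and x y :: "int ^ 'd"
  proof -
    obtain i where i: "\<bar>x $ i - y $ i\<bar> > int r" using far by blast
    then have ne: "x - y \<noteq> 0" by auto
    have "real r \<le> \<bar>real_of_int ((x - y) $ i)\<bar>" using i by simp
    then have "(real r)\<^sup>2 \<le> (real_of_int ((x - y) $ i))\<^sup>2" by (metis abs_le_square_iff abs_of_nat)
    then have "(real r)\<^sup>2 \<le> sqnorm (x - y) + 4" using component_le_sqnorm[of "x - y" i] by linarith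
    then have "real r \<le> sqrt (sqnorm (x - y) + 4)" by (rule real_le_rsqrt)
    then have "lyap (x - y) \<le> 1 / real r" using ne r0 by (auto simp: lyap_def frac_le)
    also have "1 / real r \<le> \<epsilon> * c" using r r0 c assms(2) by (simp add: field_simps)
    finally have "lyap (x - y) / c \<le> \<epsilon>" using c by (simp add: field_simps)
    then show ?thesis using green_box_le_lyap[OF d3, of n x y] by (simp add: c_def)
  qed
  then show ?thesis by (rule that)
qed

subsection \<open>Joint characteristic functions determine rectangle probabilities\<close>

lemma (in prob_space) integrable_bounded_mult:
  fixes W f :: "'a \<Rightarrow> real"
  assumes [measurable]: "W \<in> borel_measurable M" "f \<in> borel_measurable M"
    and "\<And>x. \<bar>W x\<bar> \<le> B" "\<And>x. \<bar>f x\<bar> \<le> C"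
  shows "integrable M (\<lambda>x. W x * f x)"
proof (rule integrable_const_bound[where B = "B * C"])
  show "AE x in M. norm (W x * f x) \<le> B * C"
    using assms(3,4) by (auto simp: abs_mult intro!: mult_mono order_trans[OF abs_ge_zero])
qed auto

text \<open>Normalising the weights reduces this to uniqueness for probability measures.\<close>

lemma weighted_Levy_uniqueness:
  fixes V1 W1 :: "'a \<Rightarrow> real" and V2 W2 :: "'b \<Rightarrow> real"
  assumes "prob_space M1" "prob_space M2"
    and [measurable]: "V1 \<in> borel_measurable M1" "V2 \<in> borel_measurable M2"
      "W1 \<in> borel_measurable M1" "W2 \<in> borel_measurable M2"
    and W: "\<And>x. 0 \<le> W1 x" "\<And>x. W1 x \<le> B" "\<And>x. 0 \<le> W2 x" "\<And>x. W2 x \<le> B"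
    and cos_eq: "\<And>s. (\<integral>x. W1 x * cos (s * V1 x) \<partial>M1) = (\<integral>x. W2 x * cos (s * V2 x) \<partial>M2)"
    and sin_eq: "\<And>s. (\<integral>x. W1 x * sin (s * V1 x) \<partial>M1) = (\<integral>x. W2 x * sin (s * V2 x) \<partial>M2)"
    and A [measurable]: "A \<in> sets borel"
  shows "(\<integral>x. W1 x * indicator A (V1 x) \<partial>M1) = (\<integral>x. W2 x * indicator A (V2 x) \<partial>M2)"
proof -
  interpret P1: prob_space M1 by fact
  interpret P2: prob_space M2 by fact
  define m where "m = (\<integral>x. W1 x \<partial>M1)"
  have m2: "m = (\<integral>x. W2 x \<partial>M2)" using cos_eq[of 0] by (simp add: m_def)
  have aW: "\<And>x. \<bar>W1 x\<bar> \<le> B" "\<And>x. \<bar>W2 x\<bar> \<le> B" using W by (simp_all add: abs_of_nonneg)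
  have int: "integrable M1 W1" "integrable M2 W2"
    using P1.integrable_bounded_mult[of W1 "\<lambda>_. 1" B 1] P2.integrable_bounded_mult[of W2 "\<lambda>_. 1" B 1] aW by auto
  show ?thesis
  proof (cases "m = 0")
    case True
    have "AE x in M1. W1 x = 0" "AE x in M2. W2 x = 0"
      using integral_nonneg_eq_0_iff_AE[OF int(1)] integral_nonneg_eq_0_iff_AE[OF int(2)] True m2 W
      by (auto simp: m_def)
    then have "(\<integral>x. W1 x * indicator A (V1 x) \<partial>M1) = 0" "(\<integral>x. W2 x * indicator A (V2 x) \<partial>M2) = 0"
      by (auto intro!: integral_eq_zero_AE elim!: eventually_mono)
    then show ?thesis by simp
  next
    case False
    have mpos: "m > 0" using False W by (auto simp: m_def less_le intro!: integral_nonneg)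
    have main: "real_distribution (distr (density M (\<lambda>x. W x / m)) borel V) \<and>
       (\<forall>t. char (distr (density M (\<lambda>x. W x / m)) borel V) t =
         Complex ((\<integral>x. W x * cos (t * V x) \<partial>M) / m) ((\<integral>x. W x * sin (t * V x) \<partial>M) / m)) \<and>
       measure (distr (density M (\<lambda>x. W x / m)) borel V) A = (\<integral>x. W x * indicator A (V x) \<partial>M) / m"
      if "prob_space M" and [measurable]: "V \<in> borel_measurable M" "W \<in> borel_measurable M"
        and W: "\<And>x. 0 \<le> W x" "\<And>x. \<bar>W x\<bar> \<le> B" and m: "m = (\<integral>x. W x \<partial>M)"
      for M :: "'c measure" and V W :: "'c \<Rightarrow> real"
    proof (intro conjI allI)
      interpret P: prob_space M by fact
      let ?N = "density M (\<lambda>x. ennreal (W x / m))"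
      have intW: "integrable M W" using P.integrable_bounded_mult[of W "\<lambda>_. 1" B 1] W by auto
      have "(\<integral>\<^sup>+x. ennreal (W x / m) \<partial>M) = ennreal (\<integral>x. W x / m \<partial>M)"
        using intW W mpos by (intro nn_integral_eq_integral) auto
      also have "(\<integral>x. W x / m \<partial>M) = 1" using m mpos by simp
      finally have "emeasure ?N (space ?N) = 1" by (simp add: emeasure_density cong: nn_integral_cong)
      then interpret N: prob_space ?N by (rule prob_spaceI)
      have VN: "V \<in> measurable ?N borel" by simp
      show rd: "real_distribution (distr ?N borel V)"
        using VN by (rule N.real_distribution_distr)
      show "measure (distr ?N borel V) A = (\<integral>x. W x * indicator A (V x) \<partial>M) / m"
      proof -
        interpret R: real_distribution "distr ?N borel V" by (rule rd)
        have "measure (distr ?N borel V) A = (\<integral>x. indicator A x \<partial>distr ?N borel V)" by simp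
        also have "\<dots> = (\<integral>x. indicator A (V x) \<partial>?N)" by (rule integral_distr) auto
        also have "\<dots> = (\<integral>x. (W x / m) *\<^sub>R indicator A (V x) \<partial>M)"
          using W mpos by (intro integral_density) auto
        finally show ?thesis by simp
      qed
      fix t
      have cx: "integrable M (\<lambda>x. (W x / m) *\<^sub>R iexp (t * V x))"
      proof (rule P.integrable_const_bound[where B = "B / m"])
        show "AE x in M. norm ((W x / m) *\<^sub>R iexp (t * V x)) \<le> B / m"
          using W mpos by (auto simp: norm_mult divide_right_mono simp del: of_real_mult)
      qed auto
      have "char (distr ?N borel V) t = (\<integral>x. iexp (t * V x) \<partial>?N)"
        unfolding char_def by (rule integral_distr) auto
      also have "\<dots> = (\<integral>x. (W x / m) *\<^sub>R iexp (t * V x) \<partial>M)"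
        using W mpos by (intro integral_density) auto
      also have "\<dots> = Complex (\<integral>x. Re ((W x / m) *\<^sub>R iexp (t * V x)) \<partial>M) (\<integral>x. Im ((W x / m) *\<^sub>R iexp (t * V x)) \<partial>M)"
        using integral_Re[OF cx] integral_Im[OF cx] by (simp only: complex_eq_iff complex.sel)
      also have "(\<lambda>x. Re ((W x / m) *\<^sub>R iexp (t * V x))) = (\<lambda>x. W x * cos (t * V x) / m)"
        by (auto simp: Re_exp Im_exp)
      also have "(\<lambda>x. Im ((W x / m) *\<^sub>R iexp (t * V x))) = (\<lambda>x. W x * sin (t * V x) / m)"
        by (auto simp: Re_exp Im_exp)
      finally show "char (distr ?N borel V) t =
         Complex ((\<integral>x. W x * cos (t * V x) \<partial>M) / m) ((\<integral>x. W x * sin (t * V x) \<partial>M) / m)" by simp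
    qed
    note 1 = main[OF assms(1), of V1 W1, OF _ _ W(1) aW(1) m_def]
    note 2 = main[OF assms(2), of V2 W2, OF _ _ W(3) aW(2) m2]
    have "distr (density M1 (\<lambda>x. W1 x / m)) borel V1 = distr (density M2 (\<lambda>x. W2 x / m)) borel V2"
      using 1 2 by (intro Levy_uniqueness ext) (auto simp: cos_eq sin_eq)
    then show ?thesis using 1 2 mpos by simp
  qed
qed

text \<open>Induction on the coordinates: the indicator of a treated coordinate is absorbed into the
  weight, which stays between 0 and \<open>B\<close>; hence the general weights. The hypotheses for
  the new weight follow from one-dimensional uniqueness for coordinate j, with the trigonometric
  function of the other coordinates put into the weight.\<close>

lemma rectangle_integral_eq:
  fixes V1 :: "'i \<Rightarrow> 'a \<Rightarrow> real" and V2 :: "'i \<Rightarrow> 'b \<Rightarrow> real"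
  assumes "finite I" "prob_space M1" "prob_space M2"
    and "\<And>i. V1 i \<in> borel_measurable M1" "\<And>i. V2 i \<in> borel_measurable M2"
    and "W1 \<in> borel_measurable M1" "W2 \<in> borel_measurable M2"
    and "\<And>x. 0 \<le> W1 x" "\<And>x. W1 x \<le> B" "\<And>x. 0 \<le> W2 x" "\<And>x. W2 x \<le> B"
    and "\<And>t. (\<integral>x. W1 x * cos (\<Sum>i\<in>I. t i * V1 i x) \<partial>M1) = (\<integral>x. W2 x * cos (\<Sum>i\<in>I. t i * V2 i x) \<partial>M2)"
    and "\<And>t. (\<integral>x. W1 x * sin (\<Sum>i\<in>I. t i * V1 i x) \<partial>M1) = (\<integral>x. W2 x * sin (\<Sum>i\<in>I. t i * V2 i x) \<partial>M2)"
    and A: "\<And>i. A i \<in> sets borel"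
  shows "(\<integral>x. W1 x * (\<Prod>i\<in>I. indicator (A i) (V1 i x)) \<partial>M1) = (\<integral>x. W2 x * (\<Prod>i\<in>I. indicator (A i) (V2 i x)) \<partial>M2)"
  using assms(1,6-13)
proof (induction I arbitrary: W1 W2 rule: finite_induct)
  case empty
  then show ?case by simp
next
  case (insert j I)
  interpret P1: prob_space M1 by fact
  interpret P2: prob_space M2 by fact
  note [measurable] = assms(4,5) A insert.prems(1,2)
  note W = insert.prems(3-6)
  have aW: "\<And>x. \<bar>W1 x\<bar> \<le> B" "\<And>x. \<bar>W2 x\<bar> \<le> B" using W by (simp_all add: abs_of_nonneg)
  have B0: "B \<ge> 0" using W(1,2) by (meson order_trans)
  define T1 T2 where "T1 = (\<lambda>t x. \<Sum>i\<in>I. t i * V1 i x)" and "T2 = (\<lambda>t x. \<Sum>i\<in>I. t i * V2 i x)"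
  have [measurable]: "\<And>t. T1 t \<in> borel_measurable M1" "\<And>t. T2 t \<in> borel_measurable M2"
    by (auto simp: T1_def T2_def)
  have upd: "(\<Sum>i\<in>insert j I. (t(j := s)) i * V1 i x) = s * V1 j x + T1 t x"
     "(\<Sum>i\<in>insert j I. (t(j := s)) i * V2 i y) = s * V2 j y + T2 t y" for t s x y
    using insert.hyps by (auto simp: T1_def T2_def intro!: sum.cong)
  have C: "(\<integral>x. W1 x * cos (s * V1 j x + T1 t x) \<partial>M1) = (\<integral>x. W2 x * cos (s * V2 j x + T2 t x) \<partial>M2)" for s t
    using insert.prems(7)[of "t(j := s)"] unfolding upd .
  have S: "(\<integral>x. W1 x * sin (s * V1 j x + T1 t x) \<partial>M1) = (\<integral>x. W2 x * sin (s * V2 j x + T2 t x) \<partial>M2)" for s t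
    using insert.prems(8)[of "t(j := s)"] unfolding upd .
  have neg: "T1 (\<lambda>i. - t i) x = - T1 t x" "T2 (\<lambda>i. - t i) y = - T2 t y" for t x y
    by (auto simp: T1_def T2_def sum_negf)
  have Cn: "(\<integral>x. W1 x * cos (s * V1 j x - T1 t x) \<partial>M1) = (\<integral>x. W2 x * cos (s * V2 j x - T2 t x) \<partial>M2)" for s t
    using C[of s "\<lambda>i. - t i"] by (simp add: neg)
  have Sn: "(\<integral>x. W1 x * sin (s * V1 j x - T1 t x) \<partial>M1) = (\<integral>x. W2 x * sin (s * V2 j x - T2 t x) \<partial>M2)" for s t
    using S[of s "\<lambda>i. - t i"] by (simp add: neg)
  have T0: "T1 (\<lambda>_. 0) x = 0" "T2 (\<lambda>_. 0) y = 0" for x y by (auto simp: T1_def T2_def)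
  have C0: "(\<integral>x. W1 x * cos (s * V1 j x) \<partial>M1) = (\<integral>x. W2 x * cos (s * V2 j x) \<partial>M2)" for s
    using C[of s "\<lambda>_. 0"] by (simp add: T0)
  have S0: "(\<integral>x. W1 x * sin (s * V1 j x) \<partial>M1) = (\<integral>x. W2 x * sin (s * V2 j x) \<partial>M2)" for s
    using S[of s "\<lambda>_. 0"] by (simp add: T0)
  have i1: "integrable M1 (\<lambda>x. W1 x * f x)" if "f \<in> borel_measurable M1" "\<And>x. \<bar>f x\<bar> \<le> 1" for f
    by (rule P1.integrable_bounded_mult[where C = 1, OF _ _ aW(1)]) (use that in auto)
  have i2: "integrable M2 (\<lambda>x. W2 x * f x)" if "f \<in> borel_measurable M2" "\<And>x. \<bar>f x\<bar> \<le> 1" for f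
    by (rule P2.integrable_bounded_mult[where C = 1, OF _ _ aW(2)]) (use that in auto)
  have W2B: "W1 x * (1 + c) \<le> 2 * B \<and> 0 \<le> W1 x * (1 + c)" "W2 y * (1 + c) \<le> 2 * B \<and> 0 \<le> W2 y * (1 + c)"
    if "-1 \<le> c" "c \<le> 1" for c x y
    using mult_mono[OF W(2) _ B0, of "1 + c" 2 x] mult_mono[OF W(4) _ B0, of "1 + c" 2 y] W that
    by (auto simp: mult.commute)
  have R0: "(\<integral>x. W1 x * indicator (A j) (V1 j x) \<partial>M1) = (\<integral>x. W2 x * indicator (A j) (V2 j x) \<partial>M2)"
    by (rule weighted_Levy_uniqueness[OF assms(2,3) _ _ _ _ W C0 S0]) auto
  \<comment> \<open>By these product formulas the integrals reduce to the hypotheses, with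
    coefficient s at j and either \<open>t\<close> or its negative elsewhere.\<close>
  have e1: "W * (1 + cos b) * cos a = W * cos a + (W * cos (a + b) + W * cos (a - b)) / 2"
    and e2: "W * (1 + cos b) * sin a = W * sin a + (W * sin (a + b) + W * sin (a - b)) / 2"
    and e3: "W * (1 + sin b) * cos a = W * cos a + (W * sin (a + b) - W * sin (a - b)) / 2"
    and e4: "W * (1 + sin b) * sin a = W * sin a + (W * cos (a - b) - W * cos (a + b)) / 2" for W a b :: real
    by (simp_all add: cos_add cos_diff sin_add sin_diff algebra_simps)
  \<comment> \<open>Cosine and sine change sign, so 1 is added to keep the weight nonnegative. Its
    contribution \<open>R0\<close> is subtracted again in \<open>IC\<close> and
    \<open>IS\<close>.\<close>
  have Rc: "(\<integral>x. (W1 x * (1 + cos (T1 t x))) * indicator (A j) (V1 j x) \<partial>M1) =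
        (\<integral>x. (W2 x * (1 + cos (T2 t x))) * indicator (A j) (V2 j x) \<partial>M2)" for t
  proof (rule weighted_Levy_uniqueness[OF assms(2,3), where B = "2 * B"])
    fix s
    show "(\<integral>x. W1 x * (1 + cos (T1 t x)) * cos (s * V1 j x) \<partial>M1) = (\<integral>x. W2 x * (1 + cos (T2 t x)) * cos (s * V2 j x) \<partial>M2)"
      unfolding e1 using C[of s t] Cn[of s t] C0[of s] i1 i2 by simp
    show "(\<integral>x. W1 x * (1 + cos (T1 t x)) * sin (s * V1 j x) \<partial>M1) = (\<integral>x. W2 x * (1 + cos (T2 t x)) * sin (s * V2 j x) \<partial>M2)"
      unfolding e2 using S[of s t] Sn[of s t] S0[of s] i1 i2 by simp
  qed (use W2B in auto)
  have Rs: "(\<integral>x. (W1 x * (1 + sin (T1 t x))) * indicator (A j) (V1 j x) \<partial>M1) =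
        (\<integral>x. (W2 x * (1 + sin (T2 t x))) * indicator (A j) (V2 j x) \<partial>M2)" for t
  proof (rule weighted_Levy_uniqueness[OF assms(2,3), where B = "2 * B"])
    fix s
    show "(\<integral>x. W1 x * (1 + sin (T1 t x)) * cos (s * V1 j x) \<partial>M1) = (\<integral>x. W2 x * (1 + sin (T2 t x)) * cos (s * V2 j x) \<partial>M2)"
      unfolding e3 using S[of s t] Sn[of s t] C0[of s] i1 i2 by simp
    show "(\<integral>x. W1 x * (1 + sin (T1 t x)) * sin (s * V1 j x) \<partial>M1) = (\<integral>x. W2 x * (1 + sin (T2 t x)) * sin (s * V2 j x) \<partial>M2)"
      unfolding e4 using C[of s t] Cn[of s t] S0[of s] i1 i2 by simp
  qed (use W2B in auto)
  have ind1: "\<bar>indicator X y * g\<bar> \<le> (1::real)" "\<bar>indicator X y\<bar> \<le> (1::real)"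
    if "\<bar>g\<bar> \<le> 1" for X :: "real set" and y and g :: real
    using that by (auto simp: indicator_def)
  have e5: "W * (1 + g) * h = W * h + W * (h * g)" for W g h :: real by (simp add: algebra_simps)
  have IC: "(\<integral>x. (W1 x * indicator (A j) (V1 j x)) * cos (T1 t x) \<partial>M1) =
      (\<integral>x. (W2 x * indicator (A j) (V2 j x)) * cos (T2 t x) \<partial>M2)" for t
    using Rc[of t] R0 i1 i2 ind1 unfolding e5 by (simp add: mult.assoc)
  have IS: "(\<integral>x. (W1 x * indicator (A j) (V1 j x)) * sin (T1 t x) \<partial>M1) =
      (\<integral>x. (W2 x * indicator (A j) (V2 j x)) * sin (T2 t x) \<partial>M2)" for t
    using Rs[of t] R0 i1 i2 ind1 unfolding e5 by (simp add: mult.assoc)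
  have "(\<integral>x. (W1 x * indicator (A j) (V1 j x)) * (\<Prod>i\<in>I. indicator (A i) (V1 i x)) \<partial>M1) =
     (\<integral>x. (W2 x * indicator (A j) (V2 j x)) * (\<Prod>i\<in>I. indicator (A i) (V2 i x)) \<partial>M2)"
    by (rule insert.IH) (use W B0 IC IS in \<open>auto simp: T1_def T2_def indicator_def\<close>)
  then show ?case using insert.hyps by (simp add: mult.assoc)
qed

subsection \<open>Exceedance sets of positively correlated Gaussian families\<close>

text \<open>The bridge from sets to coordinates: it turns equality of rectangle integrals into
  equality in law of exceedance sets, and it gives measurability of every function of such a
  set.\<close>

lemma set_fun_expand:
  fixes v :: "'i \<Rightarrow> real" and g :: "'i set \<Rightarrow> real"
  assumes "finite B"
  shows "g {y \<in> B. u \<le> v y} =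
    (\<Sum>S\<in>Pow B. g S * (\<Prod>y\<in>B. indicator (if y \<in> S then {u..} else {..<u}) (v y)))"
proof -
  have "(\<Prod>y\<in>B. indicator (if y \<in> S then {u..} else {..<u}) (v y)) = (if S = {y \<in> B. u \<le> v y} then 1 else (0::real))"
    if S: "S \<in> Pow B" for S
  proof (cases "S = {y \<in> B. u \<le> v y}")
    case True
    then show ?thesis by (auto intro!: prod.neutral)
  next
    case False
    then obtain y where "y \<in> B" "y \<in> S \<longleftrightarrow> \<not> u \<le> v y" using S by blast
    then have "indicator (if y \<in> S then {u..} else {..<u}) (v y) = (0::real)" by auto
    then have "(\<Prod>y\<in>B. indicator (if y \<in> S then {u..} else {..<u}) (v y)) = (0::real)"
      using assms \<open>y \<in> B\<close> by (intro prod_zero bexI)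
    then show ?thesis using False by simp
  qed
  then have "(\<Sum>S\<in>Pow B. g S * (\<Prod>y\<in>B. indicator (if y \<in> S then {u..} else {..<u}) (v y)))
      = (\<Sum>S\<in>Pow B. if S = {y \<in> B. u \<le> v y} then g S else 0)"
    by (intro sum.cong) auto
  also have "\<dots> = g {y \<in> B. u \<le> v y}" using assms by (auto simp: sum.delta)
  finally show ?thesis by simp
qed

lemma measurable_set_fun [measurable (raw)]:
  fixes V :: "'i \<Rightarrow> 'a \<Rightarrow> real" and g :: "'i set \<Rightarrow> real"
  assumes "finite B" and [measurable]: "\<And>y. V y \<in> borel_measurable M"
  shows "(\<lambda>\<omega>. g {y \<in> B. u \<le> V y \<omega>}) \<in> borel_measurable M"
proof -
  have "(\<lambda>\<omega>. \<Sum>S\<in>Pow B. g S * (\<Prod>y\<in>B. indicator (if y \<in> S then {u..} else {..<u}) (V y \<omega>))) \<in> borel_measurable M"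
    by (intro borel_measurable_sum borel_measurable_times borel_measurable_prod) auto
  then show ?thesis by (simp only: set_fun_expand[OF assms(1), of g u "\<lambda>y. V y \<omega>" for \<omega>])
qed

lemma abs_set_fun_le:
  fixes g :: "'i set \<Rightarrow> real"
  assumes "finite B" "S \<subseteq> B"
  shows "\<bar>g S\<bar> \<le> (\<Sum>T\<in>Pow B. \<bar>g T\<bar>)"
  using assms by (intro member_le_sum[of S "Pow B" "\<lambda>T. \<bar>g T\<bar>"]) auto

lemma (in prob_space) integrable_set_fun:
  fixes V :: "'i \<Rightarrow> 'a \<Rightarrow> real" and g :: "'i set \<Rightarrow> real"
  assumes "finite B" and [measurable]: "\<And>y. V y \<in> borel_measurable M"
  shows "integrable M (\<lambda>\<omega>. g {y \<in> B. u \<le> V y \<omega>})"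
  using assms(1) abs_set_fun_le[OF assms(1)]
  by (intro integrable_const_bound[where B = "\<Sum>T\<in>Pow B. \<bar>g T\<bar>"]) (auto intro!: AE_I2)

lemma threshold_law_eq:
  fixes V1 :: "'i \<Rightarrow> 'a \<Rightarrow> real" and V2 :: "'i \<Rightarrow> 'b \<Rightarrow> real" and g :: "'i set \<Rightarrow> real"
  assumes B: "finite B" and "prob_space M1" "prob_space M2"
    and [measurable]: "\<And>i. V1 i \<in> borel_measurable M1" "\<And>i. V2 i \<in> borel_measurable M2"
    and c: "\<And>t. (\<integral>x. cos (\<Sum>i\<in>B. t i * V1 i x) \<partial>M1) = (\<integral>x. cos (\<Sum>i\<in>B. t i * V2 i x) \<partial>M2)"
    and s: "\<And>t. (\<integral>x. sin (\<Sum>i\<in>B. t i * V1 i x) \<partial>M1) = (\<integral>x. sin (\<Sum>i\<in>B. t i * V2 i x) \<partial>M2)"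
  shows "(\<integral>\<omega>. g {y \<in> B. u \<le> V1 y \<omega>} \<partial>M1) = (\<integral>\<omega>. g {y \<in> B. u \<le> V2 y \<omega>} \<partial>M2)"
proof -
  interpret P1: prob_space M1 by fact
  interpret P2: prob_space M2 by fact
  define A where "A = (\<lambda>S (y :: 'i). if y \<in> S then {u..} else {..<u})"
  have A: "A S y \<in> sets borel" for S :: "'i set" and y by (simp add: A_def)
  have pb: "\<bar>\<Prod>y\<in>B. indicator (A S y) (v y)\<bar> \<le> (1::real)" for S v
    by (auto simp: abs_prod indicator_def intro!: prod_le_1)
  have i1: "integrable M1 (\<lambda>\<omega>. g S * (\<Prod>y\<in>B. indicator (A S y) (V1 y \<omega>)))" for S
    by (rule P1.integrable_bounded_mult[where B = "\<bar>g S\<bar>" and C = 1])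
      (use A pb in \<open>auto intro!: borel_measurable_prod simp: A_def\<close>)
  have i2: "integrable M2 (\<lambda>\<omega>. g S * (\<Prod>y\<in>B. indicator (A S y) (V2 y \<omega>)))" for S
    by (rule P2.integrable_bounded_mult[where B = "\<bar>g S\<bar>" and C = 1])
      (use A pb in \<open>auto intro!: borel_measurable_prod simp: A_def\<close>)
  have "(\<integral>\<omega>. 1 * (\<Prod>y\<in>B. indicator (A S y) (V1 y \<omega>)) \<partial>M1) = (\<integral>\<omega>. 1 * (\<Prod>y\<in>B. indicator (A S y) (V2 y \<omega>)) \<partial>M2 :: real)" for S
    by (rule rectangle_integral_eq[OF B assms(2,3), where B = 1]) (use A c s in simp_all)
  then have "(\<Sum>S\<in>Pow B. \<integral>\<omega>. g S * (\<Prod>y\<in>B. indicator (A S y) (V1 y \<omega>)) \<partial>M1) =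
     (\<Sum>S\<in>Pow B. \<integral>\<omega>. g S * (\<Prod>y\<in>B. indicator (A S y) (V2 y \<omega>)) \<partial>M2)" by simp
  then show ?thesis
    unfolding set_fun_expand[OF B, of g u "\<lambda>y. V1 y \<omega>" for \<omega>] set_fun_expand[OF B, of g u "\<lambda>y. V2 y \<omega>" for \<omega>]
    using i1 i2 unfolding A_def by (subst (1 2) Bochner_Integration.integral_sum) auto
qed

section \<open>Gaussian characteristic functions and regression on one coordinate\<close>

lemma (in prob_space) centred_gaussian_cos_sin:
  assumes "centred_gaussian_rv M X v"
  shows "(\<integral>\<omega>. cos (X \<omega>) \<partial>M) = exp (- v / 2)" "(\<integral>\<omega>. sin (X \<omega>) \<partial>M) = 0"
proof -
  have [measurable]: "X \<in> borel_measurable M" using assms by (simp add: centred_gaussian_rv_def)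
  have "(\<integral>\<omega>. cos (X \<omega>) \<partial>M) = exp (- v / 2) \<and> (\<integral>\<omega>. sin (X \<omega>) \<partial>M) = 0"
  proof (cases "v = 0")
    case True
    then have ae: "AE \<omega> in M. X \<omega> = 0" using assms by (simp add: centred_gaussian_rv_def)
    have "(\<integral>\<omega>. cos (X \<omega>) \<partial>M) = (\<integral>\<omega>. 1 \<partial>M)" "(\<integral>\<omega>. sin (X \<omega>) \<partial>M) = (\<integral>\<omega>. 0 \<partial>M)"
      by (rule integral_cong_AE; use ae in \<open>auto elim!: eventually_mono\<close>)+
    then show ?thesis using True by (simp add: prob_space)
  next
    case False
    then have v: "v > 0" and "distributed M lborel X (normal_density 0 (sqrt v))"
      using assms by (auto simp: centred_gaussian_rv_def)
    then have D: "distributed M lborel (\<lambda>x. X x / sqrt v) std_normal_density"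
      using normal_standard_normal_convert[of "sqrt v" X 0] by simp
    have dist: "distr M lborel (\<lambda>x. X x / sqrt v) = std_normal_distribution"
      using distributed_distr_eq_density[OF D] by simp
    have "complex_of_real (exp (- v / 2)) = char std_normal_distribution (sqrt v)"
      using v by (simp add: char_std_normal_distribution)
    also have "\<dots> = (\<integral>x. iexp (sqrt v * x) \<partial>distr M lborel (\<lambda>x. X x / sqrt v))"
      by (simp add: char_def dist)
    also have "\<dots> = (\<integral>\<omega>. iexp (sqrt v * (X \<omega> / sqrt v)) \<partial>M)"
      by (rule integral_distr) auto
    also have "\<dots> = (\<integral>\<omega>. iexp (X \<omega>) \<partial>M)" using v by simp
    finally have e: "(\<integral>\<omega>. iexp (X \<omega>) \<partial>M) = complex_of_real (exp (- v / 2))" ..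
    have int: "complex_integrable M (\<lambda>\<omega>. iexp (X \<omega>))" by (rule integrable_iexp) auto
    have "(\<integral>\<omega>. Re (iexp (X \<omega>)) \<partial>M) = exp (- v / 2)" "(\<integral>\<omega>. Im (iexp (X \<omega>)) \<partial>M) = 0"
      using integral_Re[OF int] integral_Im[OF int] e by simp_all
    then show ?thesis by (simp add: Re_exp Im_exp)
  qed
  then show "(\<integral>\<omega>. cos (X \<omega>) \<partial>M) = exp (- v / 2)" "(\<integral>\<omega>. sin (X \<omega>) \<partial>M) = 0" by auto
qed

locale gaussian_family = prob_space M for M :: "'a measure" +
  fixes B :: "'i set" and K :: "'i \<Rightarrow> 'i \<Rightarrow> real" and \<phi> :: "'i \<Rightarrow> 'a \<Rightarrow> real"
  assumes finite_B: "finite B"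
    and measurable_\<phi> [measurable]: "\<And>x. \<phi> x \<in> borel_measurable M"
    and gaussian: "\<And>c. centred_gaussian_rv M (\<lambda>\<omega>. \<Sum>x\<in>B. c x * \<phi> x \<omega>) (\<Sum>x\<in>B. \<Sum>y\<in>B. c x * c y * K x y)"
    and K_nonneg: "\<And>x y. x \<in> B \<Longrightarrow> y \<in> B \<Longrightarrow> K x y \<ge> 0"
    and K_diag_pos: "\<And>x. x \<in> B \<Longrightarrow> K x x > 0"
begin

text \<open>The Gaussian hypothesis sees \<open>K\<close> only through its quadratic form, which
  determines the symmetric part. This part is the covariance of the field.\<close>

definition kcov :: "'i \<Rightarrow> 'i \<Rightarrow> real" where "kcov x y = (K x y + K y x) / 2"

text \<open>The regression coefficient: \<open>\<phi> y - \<beta> x y * \<phi> x\<close> is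
  uncorrelated with \<open>\<phi> x\<close>.\<close>

definition \<beta> :: "'i \<Rightarrow> 'i \<Rightarrow> real" where "\<beta> x y = kcov x y / K x x"

text \<open>The first component carries the residuals of the regression on the value at x, the second an
  independent copy of that value.\<close>

definition resampled :: "'i \<Rightarrow> 'i \<Rightarrow> 'a \<times> 'a \<Rightarrow> real" where
  "resampled x y = (\<lambda>(a, b). \<phi> y a - \<beta> x y * \<phi> x a + \<beta> x y * \<phi> x b)"

lemma kcov_diag [simp]: "kcov x x = K x x" by (simp add: kcov_def)

lemma kcov_nonneg: "x \<in> B \<Longrightarrow> y \<in> B \<Longrightarrow> kcov x y \<ge> 0"
  by (simp add: kcov_def K_nonneg)

lemma \<beta>_nonneg: "x \<in> B \<Longrightarrow> y \<in> B \<Longrightarrow> \<beta> x y \<ge> 0"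
  by (simp add: \<beta>_def kcov_nonneg K_nonneg)

lemma \<beta>_self: "x \<in> B \<Longrightarrow> \<beta> x x = 1"
  using K_diag_pos[of x] by (simp add: \<beta>_def)

lemma resampled_self: "x \<in> B \<Longrightarrow> resampled x x (a, b) = \<phi> x b"
  by (simp add: resampled_def \<beta>_self)

lemma measurable_resampled [measurable]: "resampled x y \<in> borel_measurable (M \<Otimes>\<^sub>M M)"
  unfolding resampled_def by measurable

lemma prob_space_pair: "prob_space (M \<Otimes>\<^sub>M M)"
  by (rule prob_space_pair) unfold_locales

lemma pair_integral_eq_iterated:
  fixes f :: "'a \<times> 'a \<Rightarrow> real"
  assumes [measurable]: "f \<in> borel_measurable (M \<Otimes>\<^sub>M M)" and "\<And>z. \<bar>f z\<bar> \<le> c"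
  shows "(\<integral>z. f z \<partial>(M \<Otimes>\<^sub>M M)) = (\<integral>a. \<integral>b. f (a, b) \<partial>M \<partial>M)"
proof -
  interpret P: pair_sigma_finite M M by unfold_locales
  interpret N: prob_space "M \<Otimes>\<^sub>M M" by (rule prob_space_pair)
  have "integrable (M \<Otimes>\<^sub>M M) f"
    using assms(2) by (intro N.integrable_const_bound[where B = c]) auto
  then show ?thesis by (simp add: P.integral_fst')
qed

text \<open>In a linear combination with coefficients \<open>t\<close> the fresh value gets the
  coefficient \<open>s\<close>, the sum of the \<open>t y * \<beta> x y\<close>. It contributes the
  variance s^2 K x x, exactly what passing to the residuals removes, so the cosine and sine
  integrals are those of the original field.\<close>

lemma resampled_law:
  fixes g :: "'i set \<Rightarrow> real"
  assumes x: "x \<in> B"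
  shows "(\<integral>\<omega>. g {y \<in> B. u \<le> \<phi> y \<omega>} \<partial>M) = (\<integral>z. g {y \<in> B. u \<le> resampled x y z} \<partial>(M \<Otimes>\<^sub>M M))"
proof -
  have key: "(\<integral>z. cos (\<Sum>y\<in>B. t y * resampled x y z) \<partial>(M \<Otimes>\<^sub>M M)) = exp (- (\<Sum>y\<in>B. \<Sum>z\<in>B. t y * t z * K y z) / 2) \<and>
    (\<integral>z. sin (\<Sum>y\<in>B. t y * resampled x y z) \<partial>(M \<Otimes>\<^sub>M M)) = 0" for t
  proof -
    define s where "s = (\<Sum>y\<in>B. t y * \<beta> x y)"
    define t' where "t' = (\<lambda>y. t y - (if y = x then s else 0))"
    define X where "X = (\<lambda>b. \<Sum>y\<in>B. (if y = x then s else 0) * \<phi> y b)"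
    define Y where "Y = (\<lambda>a. \<Sum>y\<in>B. t' y * \<phi> y a)"
    have Xe: "X b = s * \<phi> x b" for b
      using x finite_B by (simp add: X_def if_distrib[of "\<lambda>c. c * _"] cong: if_cong)
    have Ye: "Y a = (\<Sum>y\<in>B. t y * \<phi> y a) - s * \<phi> x a" for a
      using x finite_B by (simp add: Y_def t'_def left_diff_distrib sum_subtractf if_distrib[of "\<lambda>c. c * _"] cong: if_cong)
    have sum_eq: "(\<Sum>y\<in>B. t y * resampled x y (a, b)) = Y a + X b" for a b
      by (simp add: resampled_def Ye Xe s_def algebra_simps sum.distrib sum_subtractf sum_distrib_left)
    have vX: "(\<Sum>y\<in>B. \<Sum>z\<in>B. (if y = x then s else 0) * (if z = x then s else 0) * K y z) = s * s * K x x"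
      using x finite_B by (simp add: if_distrib[of "\<lambda>c. c * _"] if_distrib[of "\<lambda>c. _ * c"] cong: if_cong)
    \<comment> \<open>By the definition of \<beta> the combination has covariance
      \<open>s * K x x\<close> with \<open>\<phi> x\<close>. The cross terms in \<open>vY\<close>
      are thus minus twice the square term.\<close>
    have vs: "(\<Sum>y\<in>B. t y * (K y x + K x y)) = 2 * s * K x x"
      using K_diag_pos[OF x] by (simp add: s_def \<beta>_def kcov_def sum_distrib_left sum_distrib_right add.commute)
    have vY: "(\<Sum>y\<in>B. \<Sum>z\<in>B. t' y * t' z * K y z) = (\<Sum>y\<in>B. \<Sum>z\<in>B. t y * t z * K y z) - s * s * K x x"
    proof -
      have "(\<Sum>y\<in>B. \<Sum>z\<in>B. t' y * t' z * K y z) =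
         (\<Sum>y\<in>B. \<Sum>z\<in>B. t y * t z * K y z) - (\<Sum>y\<in>B. t y * (\<Sum>z\<in>B. (if z = x then s else 0) * K y z))
         - (\<Sum>y\<in>B. (if y = x then s else 0) * (\<Sum>z\<in>B. t z * K y z)) +
         (\<Sum>y\<in>B. \<Sum>z\<in>B. (if y = x then s else 0) * (if z = x then s else 0) * K y z)"
        by (simp add: t'_def sum_subtractf[symmetric] sum.distrib[symmetric] sum_distrib_left)
          (intro sum.cong refl, simp add: algebra_simps)
      also have "(\<Sum>y\<in>B. t y * (\<Sum>z\<in>B. (if z = x then s else 0) * K y z)) = s * (\<Sum>y\<in>B. t y * K y x)"
        using x finite_B by (simp add: if_distrib[of "\<lambda>c. c * _"] cong: if_cong) (simp add: sum_distrib_left mult_ac)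
      also have "(\<Sum>y\<in>B. (if y = x then s else 0) * (\<Sum>z\<in>B. t z * K y z)) = s * (\<Sum>z\<in>B. t z * K x z)"
        using x finite_B by (simp add: if_distrib[of "\<lambda>c. c * _"] cong: if_cong)
      also note vX
      finally have "(\<Sum>y\<in>B. \<Sum>z\<in>B. t' y * t' z * K y z) = (\<Sum>y\<in>B. \<Sum>z\<in>B. t y * t z * K y z)
          - s * ((\<Sum>y\<in>B. t y * K y x) + (\<Sum>y\<in>B. t y * K x y)) + s * s * K x x"
        by (simp add: distrib_left)
      moreover have "(\<Sum>y\<in>B. t y * K y x) + (\<Sum>y\<in>B. t y * K x y) = 2 * s * K x x"
        using vs by (simp add: sum.distrib distrib_left)
      ultimately show ?thesis by simp
    qed
    have [measurable]: "X \<in> borel_measurable M" "Y \<in> borel_measurable M" by (auto simp: X_def Y_def)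
    have gX: "(\<integral>\<omega>. cos (X \<omega>) \<partial>M) = exp (- (s * s * K x x) / 2)" "(\<integral>\<omega>. sin (X \<omega>) \<partial>M) = 0"
      using centred_gaussian_cos_sin[OF gaussian[of "\<lambda>y. if y = x then s else 0"]] unfolding vX X_def by auto
    have gY: "(\<integral>\<omega>. cos (Y \<omega>) \<partial>M) = exp (- ((\<Sum>y\<in>B. \<Sum>z\<in>B. t y * t z * K y z) - s * s * K x x) / 2)"
       "(\<integral>\<omega>. sin (Y \<omega>) \<partial>M) = 0"
      using centred_gaussian_cos_sin[OF gaussian[of t']] unfolding vY Y_def by auto
    have ib: "integrable M (\<lambda>\<omega>. c * cos (X \<omega>))" "integrable M (\<lambda>\<omega>. c * sin (X \<omega>))" for c
      using integrable_bounded_mult[of "\<lambda>_. c" "\<lambda>\<omega>. cos (X \<omega>)" "\<bar>c\<bar>" 1] integrable_bounded_mult[of "\<lambda>_. c" "\<lambda>\<omega>. sin (X \<omega>)" "\<bar>c\<bar>" 1]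
      by auto
    have "(\<integral>z. cos (\<Sum>y\<in>B. t y * resampled x y z) \<partial>(M \<Otimes>\<^sub>M M)) = (\<integral>a. \<integral>b. cos (Y a) * cos (X b) - sin (Y a) * sin (X b) \<partial>M \<partial>M)"
      by (subst pair_integral_eq_iterated[where c = 1]) (auto simp: sum_eq cos_add)
    also have "\<dots> = (\<integral>a. cos (Y a) * exp (- (s * s * K x x) / 2) \<partial>M)"
      using ib by (simp add: gX)
    also have "\<dots> = exp (- (\<Sum>y\<in>B. \<Sum>z\<in>B. t y * t z * K y z) / 2)"
      by (simp add: gY exp_add[symmetric]) (simp add: field_simps)
    finally have 1: "(\<integral>z. cos (\<Sum>y\<in>B. t y * resampled x y z) \<partial>(M \<Otimes>\<^sub>M M)) = exp (- (\<Sum>y\<in>B. \<Sum>z\<in>B. t y * t z * K y z) / 2)" .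
    have "(\<integral>z. sin (\<Sum>y\<in>B. t y * resampled x y z) \<partial>(M \<Otimes>\<^sub>M M)) = (\<integral>a. \<integral>b. sin (Y a) * cos (X b) + cos (Y a) * sin (X b) \<partial>M \<partial>M)"
      by (subst pair_integral_eq_iterated[where c = 1]) (auto simp: sum_eq sin_add)
    also have "\<dots> = (\<integral>a. sin (Y a) * exp (- (s * s * K x x) / 2) \<partial>M)"
      using ib by (simp add: gX)
    also have "\<dots> = 0" by (simp add: gY)
    finally show ?thesis using 1 by simp
  qed
  show ?thesis
    by (rule threshold_law_eq[OF finite_B prob_space_axioms prob_space_pair, of \<phi> "resampled x" g u])
      (use key centred_gaussian_cos_sin[OF gaussian] in auto)
qed

lemma association:
  fixes G :: "'i set \<Rightarrow> real"
  assumes x: "x \<in> B" and mono: "\<And>S T. S \<subseteq> T \<Longrightarrow> T \<subseteq> B \<Longrightarrow> G S \<le> G T"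
  shows "(\<integral>\<omega>. indicator {u..} (\<phi> x \<omega>) \<partial>M) * (\<integral>\<omega>. G {y \<in> B. u \<le> \<phi> y \<omega>} \<partial>M)
    \<le> (\<integral>\<omega>. indicator {u..} (\<phi> x \<omega>) * G {y \<in> B. u \<le> \<phi> y \<omega>} \<partial>M)"
proof -
  interpret P: pair_sigma_finite M M by unfold_locales
  interpret N: prob_space "M \<Otimes>\<^sub>M M" by (rule prob_space_pair)
  define p where "p = (\<integral>\<omega>. indicator {u..} (\<phi> x \<omega>) \<partial>M :: real)"
  \<comment> \<open>The product of both factors is again a function of the exceedance set, so
    \<open>resampled_law\<close> applies to it.\<close>
  define h where "h = (\<lambda>S. of_bool (x \<in> S) * G S)"
  define H where "H = (\<lambda>a s. {y \<in> B. u \<le> \<phi> y a - \<beta> x y * \<phi> x a + \<beta> x y * s})"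
  have ind_int [simp]: "integrable M (\<lambda>\<omega>. indicator {u..} (\<phi> x \<omega>) :: real)"
    by (intro integrable_const_bound[where B = 1]) auto
  have p01: "0 \<le> p" "p \<le> 1"
  proof -
    show "0 \<le> p" by (simp add: p_def)
    have "p \<le> (\<integral>\<omega>. 1 \<partial>M)" unfolding p_def by (intro integral_mono ind_int) auto
    then show "p \<le> 1" by (simp add: prob_space)
  qed
  have H_mono: "H a s \<subseteq> H a t" if "s \<le> t" for a s t
  proof -
    have "\<beta> x y * s \<le> \<beta> x y * t" if "y \<in> B" for y
      using \<open>s \<le> t\<close> \<beta>_nonneg[OF x that] by (rule mult_left_mono)
    then show ?thesis by (fastforce simp: H_def)
  qed
  have H_res: "{y \<in> B. u \<le> resampled x y (a, b)} = H a (\<phi> x b)" for a b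
    by (simp add: resampled_def H_def)
  have h_res: "h (H a (\<phi> x b)) = indicator {u..} (\<phi> x b) * G (H a (\<phi> x b))" for a b
    using x by (auto simp: h_def H_def \<beta>_self)
  have int_G: "integrable (M \<Otimes>\<^sub>M M) (\<lambda>z. G {y \<in> B. u \<le> resampled x y z})"
    and int_h: "integrable (M \<Otimes>\<^sub>M M) (\<lambda>z. h {y \<in> B. u \<le> resampled x y z})"
    by (intro N.integrable_set_fun finite_B; simp)+
  have inner: "p * (\<integral>b. G (H a (\<phi> x b)) \<partial>M) \<le> (\<integral>b. h (H a (\<phi> x b)) \<partial>M)" for a
  proof -
    define k where "k = (\<lambda>b. G (H a (\<phi> x b)))"
    have [measurable]: "k \<in> borel_measurable M"
      unfolding k_def H_def by (intro measurable_set_fun[OF finite_B]) measurable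
    have kb: "\<bar>k b\<bar> \<le> (\<Sum>T\<in>Pow B. \<bar>G T\<bar>)" for b
      unfolding k_def by (rule abs_set_fun_le[OF finite_B]) (auto simp: H_def)
    have k_int: "integrable M k" using kb by (intro integrable_const_bound[where B = "\<Sum>T\<in>Pow B. \<bar>G T\<bar>"]) auto
    have ik_int: "integrable M (\<lambda>b. indicator {u..} (\<phi> x b) * k b)"
      using kb by (intro integrable_bounded_mult[where B = 1 and C = "\<Sum>T\<in>Pow B. \<bar>G T\<bar>"]) auto
    \<comment> \<open>With the residuals frozen at a, \<open>k\<close> is nondecreasing in
      \<open>\<phi> x b\<close>, so \<open>k0\<close> separates its values above the level from
      those below. This yields the correlation inequality in one variable.\<close>
    define k0 where "k0 = G (H a u)"
    have HB: "H a s \<subseteq> B" for s by (auto simp: H_def)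
    have k1: "k0 \<le> k b" if "u \<le> \<phi> x b" for b
      unfolding k0_def k_def by (rule mono[OF H_mono[OF that] HB])
    have k2: "k b \<le> k0" if "\<phi> x b \<le> u" for b
      unfolding k0_def k_def by (rule mono[OF H_mono[OF that] HB])
    have "(\<integral>b. indicator {u..} (\<phi> x b) * k0 \<partial>M) \<le> (\<integral>b. indicator {u..} (\<phi> x b) * k b \<partial>M)"
      by (intro integral_mono ik_int integrable_mult_left ind_int) (auto simp: indicator_def k1)
    then have A1: "p * k0 \<le> (\<integral>b. indicator {u..} (\<phi> x b) * k b \<partial>M)" by (simp add: p_def)
    have "(\<integral>b. k b - indicator {u..} (\<phi> x b) * k b \<partial>M) \<le> (\<integral>b. k0 - indicator {u..} (\<phi> x b) * k0 \<partial>M)"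
      by (intro integral_mono Bochner_Integration.integrable_diff ik_int k_int integrable_mult_left ind_int integrable_const)
        (auto simp: indicator_def k2)
    then have A2: "(\<integral>b. k b \<partial>M) - (\<integral>b. indicator {u..} (\<phi> x b) * k b \<partial>M) \<le> k0 - p * k0"
      using k_int ik_int by (simp add: p_def prob_space)
    have "p * ((\<integral>b. k b \<partial>M) - (\<integral>b. indicator {u..} (\<phi> x b) * k b \<partial>M)) \<le> p * (k0 - p * k0)"
      using A2 p01 by (intro mult_left_mono)
    also have "\<dots> = (1 - p) * (p * k0)" by (simp add: algebra_simps)
    also have "\<dots> \<le> (1 - p) * (\<integral>b. indicator {u..} (\<phi> x b) * k b \<partial>M)"
      using A1 p01 by (intro mult_left_mono) auto
    finally have "p * (\<integral>b. k b \<partial>M) \<le> (\<integral>b. indicator {u..} (\<phi> x b) * k b \<partial>M)"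
      by (simp add: algebra_simps)
    then show ?thesis by (simp add: k_def h_res)
  qed
  have "p * (\<integral>\<omega>. G {y \<in> B. u \<le> \<phi> y \<omega>} \<partial>M) = p * (\<integral>a. \<integral>b. G (H a (\<phi> x b)) \<partial>M \<partial>M)"
    unfolding resampled_law[OF x, of G u] using P.integral_fst'[OF int_G] by (simp add: H_res)
  also have "\<dots> = (\<integral>a. p * (\<integral>b. G (H a (\<phi> x b)) \<partial>M) \<partial>M)" by simp
  also have "\<dots> \<le> (\<integral>a. \<integral>b. h (H a (\<phi> x b)) \<partial>M \<partial>M)"
    using P.integrable_fst'[OF int_G] P.integrable_fst'[OF int_h] inner
    by (intro integral_mono) (auto simp: H_res)
  also have "\<dots> = (\<integral>\<omega>. h {y \<in> B. u \<le> \<phi> y \<omega>} \<partial>M)"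
    unfolding resampled_law[OF x, of h u] using P.integral_fst'[OF int_h] by (simp add: H_res)
  also have "\<dots> = (\<integral>\<omega>. indicator {u..} (\<phi> x \<omega>) * G {y \<in> B. u \<le> \<phi> y \<omega>} \<partial>M)"
    using x by (intro Bochner_Integration.integral_cong) (auto simp: h_def)
  finally show ?thesis by (simp add: p_def)
qed

section \<open>Replacing dependent indicators by independent ones\<close>

definition exceed :: "real \<Rightarrow> 'i \<Rightarrow> real" where
  "exceed u x = (\<integral>\<omega>. indicator {u..} (\<phi> x \<omega>) \<partial>M)"

definition exceed_cov :: "real \<Rightarrow> 'i \<Rightarrow> 'i \<Rightarrow> real" where
  "exceed_cov u x y = (\<integral>\<omega>. indicator {u..} (\<phi> x \<omega>) * indicator {u..} (\<phi> y \<omega>) \<partial>M) - exceed u x * exceed u y"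

text \<open>A bounded function of the exceedance set becomes increasing after adding twice the number of
  exceedances, so association controls its covariance with a single exceedance.\<close>

lemma abs_cov_exceedance_le:
  fixes g :: "'i set \<Rightarrow> real"
  assumes x: "x \<in> B" and D: "D \<subseteq> B" and g: "\<And>S. \<bar>g S\<bar> \<le> 1"
  shows "\<bar>\<integral>\<omega>. (indicator {u..} (\<phi> x \<omega>) - exceed u x) * g {y \<in> D. u \<le> \<phi> y \<omega>} \<partial>M\<bar>
    \<le> 2 * (\<Sum>y\<in>D. exceed_cov u x y)"
proof -
  have finD: "finite D" using D finite_B finite_subset by blast
  define I where "I = (\<lambda>y \<omega>. indicator {u..} (\<phi> y \<omega>) :: real)"
  have [measurable]: "I y \<in> borel_measurable M" for y unfolding I_def by measurable
  have I1: "\<bar>I y \<omega>\<bar> \<le> 1" for y \<omega> by (simp add: I_def)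
  have I_int: "integrable M (\<lambda>\<omega>. I x \<omega> * I y \<omega>)" "integrable M (I y)" for y
    using I1 by (intro integrable_bounded_mult[where B = 1 and C = 1]; simp)
      (use I1 in \<open>intro integrable_const_bound[where B = 1]; simp\<close>)
  define HD where "HD = (\<lambda>\<omega>. {y \<in> D. u \<le> \<phi> y \<omega>})"
  have gm [measurable]: "(\<lambda>\<omega>. g (HD \<omega>)) \<in> borel_measurable M"
    unfolding HD_def by (rule measurable_set_fun[OF finD]) auto
  have g_int: "integrable M (\<lambda>\<omega>. I x \<omega> * g (HD \<omega>))" "integrable M (\<lambda>\<omega>. g (HD \<omega>))"
    using I1 g by (intro integrable_bounded_mult[where B = 1 and C = 1]; simp)
      (use g in \<open>intro integrable_const_bound[where B = 1]; simp\<close>)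
  have card_eq: "real (card (HD \<omega>)) = (\<Sum>y\<in>D. I y \<omega>)" for \<omega>
  proof -
    have "(\<Sum>y\<in>D. I y \<omega>) = (\<Sum>y\<in>D. if u \<le> \<phi> y \<omega> then 1 else 0)" by (intro sum.cong) (auto simp: I_def)
    then show ?thesis using finD by (simp add: sum.If_cases HD_def Int_def)
  qed
  have main: "- r * ((\<integral>\<omega>. I x \<omega> * g (HD \<omega>) \<partial>M) - exceed u x * (\<integral>\<omega>. g (HD \<omega>) \<partial>M)) \<le> 2 * (\<Sum>y\<in>D. exceed_cov u x y)"
    if r: "\<bar>r\<bar> = 1" for r :: real
  proof -
    \<comment> \<open>\<open>g\<close> changes by at most 2 between two sets, whereas a strict
      inclusion adds at least 2 to the counting term. The sign \<open>r\<close> gives both halves of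
      the absolute value.\<close>
    define G where "G = (\<lambda>S. 2 * real (card (S \<inter> D)) + r * g (S \<inter> D))"
    have G_mono: "G S \<le> G T" if "S \<subseteq> T" "T \<subseteq> B" for S T
    proof (cases "S \<inter> D = T \<inter> D")
      case True
      then show ?thesis by (simp add: G_def)
    next
      case False
      then have "S \<inter> D \<subset> T \<inter> D" using that by blast
      then have "card (S \<inter> D) < card (T \<inter> D)" using finD by (intro psubset_card_mono) auto
      then have "real (card (S \<inter> D)) + 1 \<le> real (card (T \<inter> D))" by linarith
      moreover have "\<bar>r * g (S \<inter> D)\<bar> \<le> 1" "\<bar>r * g (T \<inter> D)\<bar> \<le> 1"
        using r g by (simp_all add: abs_mult)
      ultimately show ?thesis unfolding G_def by linarith
    qed
    have GH: "G {y \<in> B. u \<le> \<phi> y \<omega>} = 2 * (\<Sum>y\<in>D. I y \<omega>) + r * g (HD \<omega>)" for \<omega>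
    proof -
      have "{y \<in> B. u \<le> \<phi> y \<omega>} \<inter> D = HD \<omega>" using D by (auto simp: HD_def)
      then show ?thesis by (simp add: G_def card_eq)
    qed
    have "exceed u x * (\<integral>\<omega>. 2 * (\<Sum>y\<in>D. I y \<omega>) + r * g (HD \<omega>) \<partial>M)
       \<le> (\<integral>\<omega>. I x \<omega> * (2 * (\<Sum>y\<in>D. I y \<omega>) + r * g (HD \<omega>)) \<partial>M)"
      using association[OF x, of G u] G_mono unfolding GH by (simp add: exceed_def I_def)
    also have "(\<integral>\<omega>. I x \<omega> * (2 * (\<Sum>y\<in>D. I y \<omega>) + r * g (HD \<omega>)) \<partial>M)
       = (\<integral>\<omega>. 2 * (\<Sum>y\<in>D. I x \<omega> * I y \<omega>) + r * (I x \<omega> * g (HD \<omega>)) \<partial>M)"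
      by (simp add: algebra_simps sum_distrib_left)
    also have "\<dots> = 2 * (\<Sum>y\<in>D. \<integral>\<omega>. I x \<omega> * I y \<omega> \<partial>M) + r * (\<integral>\<omega>. I x \<omega> * g (HD \<omega>) \<partial>M)"
      using I_int g_int by simp
    also have "(\<integral>\<omega>. 2 * (\<Sum>y\<in>D. I y \<omega>) + r * g (HD \<omega>) \<partial>M) = 2 * (\<Sum>y\<in>D. exceed u y) + r * (\<integral>\<omega>. g (HD \<omega>) \<partial>M)"
      using I_int g_int by (simp add: exceed_def I_def)
    finally have "exceed u x * (2 * (\<Sum>y\<in>D. exceed u y) + r * (\<integral>\<omega>. g (HD \<omega>) \<partial>M)) \<le>
       2 * (\<Sum>y\<in>D. \<integral>\<omega>. I x \<omega> * I y \<omega> \<partial>M) + r * (\<integral>\<omega>. I x \<omega> * g (HD \<omega>) \<partial>M)" .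
    moreover have "(\<Sum>y\<in>D. exceed_cov u x y) = (\<Sum>y\<in>D. \<integral>\<omega>. I x \<omega> * I y \<omega> \<partial>M) - exceed u x * (\<Sum>y\<in>D. exceed u y)"
      by (simp add: exceed_cov_def I_def sum_subtractf sum_distrib_left)
    ultimately show ?thesis by (simp add: algebra_simps)
  qed
  have "(\<integral>\<omega>. (I x \<omega> - exceed u x) * g (HD \<omega>) \<partial>M) = (\<integral>\<omega>. I x \<omega> * g (HD \<omega>) \<partial>M) - exceed u x * (\<integral>\<omega>. g (HD \<omega>) \<partial>M)"
    using g_int by (simp add: left_diff_distrib)
  then show ?thesis using main[of 1] main[of "-1"] by (simp add: I_def HD_def)
qed

text \<open>The induction needs all \<open>h\<close> with values in [0, 1] and not only indicators
  of events: averaging one coordinate over its Bernoulli variable turns an indicator into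
  \<open>h'\<close>, which takes intermediate values.\<close>

lemma tv_exceedance_le:
  fixes h :: "'i set \<Rightarrow> real"
  assumes "D \<subseteq> B" and "\<And>S. 0 \<le> h S \<and> h S \<le> 1"
  shows "\<bar>(\<integral>\<omega>. h {y \<in> D. u \<le> \<phi> y \<omega>} \<partial>M)
      - (\<Sum>S\<in>Pow D. h S * ((\<Prod>y\<in>S. exceed u y) * (\<Prod>y\<in>D - S. 1 - exceed u y)))\<bar>
    \<le> 2 * (\<Sum>x\<in>D. \<Sum>y\<in>D - {x}. exceed_cov u x y)"
proof -
  have "finite D" using assms(1) finite_B finite_subset by blast
  then show ?thesis using assms
  proof (induction D arbitrary: h rule: finite_induct)
    case empty
    then show ?case by (simp add: prob_space)
  next
    case (insert x D)
    define p where "p = exceed u x"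
    define w where "w = (\<lambda>S. (\<Prod>y\<in>S. exceed u y) * (\<Prod>y\<in>D - S. 1 - exceed u y))"
    define HD where "HD = (\<lambda>\<omega>. {y \<in> D. u \<le> \<phi> y \<omega>})"
    define I where "I = (\<lambda>\<omega>. indicator {u..} (\<phi> x \<omega>) :: real)"
    define h' where "h' = (\<lambda>S. p * h (insert x S) + (1 - p) * h S)"
    define g where "g = (\<lambda>S. h (insert x S) - h S)"
    have xB: "x \<in> B" and DB: "D \<subseteq> B" using insert.prems by auto
    have p01: "0 \<le> p" "p \<le> 1"
    proof -
      show "0 \<le> p" by (simp add: p_def exceed_def)
      have "p \<le> (\<integral>\<omega>. 1 \<partial>M)" unfolding p_def exceed_def
        by (intro integral_mono integrable_const_bound[where B = 1]) (auto simp: indicator_def)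
      then show "p \<le> 1" by (simp add: prob_space)
    qed
    have h'01: "0 \<le> h' S \<and> h' S \<le> 1" for S
      using insert.prems(2) p01 convex_bound_le[of "h (insert x S)" 1 "h S" p "1 - p"] by (auto simp: h'_def)
    have g1: "\<bar>g S\<bar> \<le> 1" for S using insert.prems(2)[of S] insert.prems(2)[of "insert x S"] by (auto simp: g_def)
    \<comment> \<open>The error of one replacement is the centred indicator at x times the discrete
      derivative \<open>g\<close>, a function of the other indicators.\<close>
    have set_eq: "h {y \<in> insert x D. u \<le> \<phi> y \<omega>} = h' (HD \<omega>) + (I \<omega> - p) * g (HD \<omega>)" for \<omega>
    proof -
      have "{y \<in> insert x D. u \<le> \<phi> y \<omega>} = (if u \<le> \<phi> x \<omega> then insert x (HD \<omega>) else HD \<omega>)"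
        by (auto simp: HD_def)
      then show ?thesis by (auto simp: h'_def g_def I_def algebra_simps)
    qed
    have int1: "integrable M (\<lambda>\<omega>. h' (HD \<omega>))" "integrable M (\<lambda>\<omega>. g (HD \<omega>))"
      unfolding HD_def by (intro integrable_set_fun insert.hyps; simp)+
    have gm: "(\<lambda>\<omega>. g (HD \<omega>)) \<in> borel_measurable M" using int1(2) by simp
    have int2: "integrable M (\<lambda>\<omega>. (I \<omega> - p) * g (HD \<omega>))"
    proof (rule integrable_bounded_mult[where B = 1 and C = 1, OF _ gm])
      show "\<bar>I \<omega> - p\<bar> \<le> 1" for \<omega> using p01 by (auto simp: I_def indicator_def)
    qed (use g1 in \<open>auto simp: I_def\<close>)
    have L: "(\<integral>\<omega>. h {y \<in> insert x D. u \<le> \<phi> y \<omega>} \<partial>M) = (\<integral>\<omega>. h' (HD \<omega>) \<partial>M) + (\<integral>\<omega>. (I \<omega> - p) * g (HD \<omega>) \<partial>M)"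
      unfolding set_eq using int1 int2 by simp
    have R: "(\<Sum>S\<in>Pow (insert x D). h S * ((\<Prod>y\<in>S. exceed u y) * (\<Prod>y\<in>insert x D - S. 1 - exceed u y)))
        = (\<Sum>S\<in>Pow D. h' S * w S)"
    proof -
      have fS: "finite S" "x \<notin> S" if "S \<in> Pow D" for S using that insert.hyps finite_subset by auto
      have inj: "inj_on (insert x) (Pow D)" using insert.hyps by (auto simp: inj_on_def)
      have "(\<Sum>S\<in>Pow (insert x D). h S * ((\<Prod>y\<in>S. exceed u y) * (\<Prod>y\<in>insert x D - S. 1 - exceed u y)))
         = (\<Sum>S\<in>Pow D. h S * ((\<Prod>y\<in>S. exceed u y) * (\<Prod>y\<in>insert x D - S. 1 - exceed u y)))
         + (\<Sum>S\<in>Pow D. h (insert x S) * ((\<Prod>y\<in>insert x S. exceed u y) * (\<Prod>y\<in>insert x D - insert x S. 1 - exceed u y)))"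
        unfolding Pow_insert using insert.hyps
        by (subst sum.union_disjoint) (auto simp: sum.reindex[OF inj])
      also have "(\<Sum>S\<in>Pow D. h S * ((\<Prod>y\<in>S. exceed u y) * (\<Prod>y\<in>insert x D - S. 1 - exceed u y)))
          = (\<Sum>S\<in>Pow D. (1 - p) * h S * w S)"
      proof (intro sum.cong refl)
        fix S assume S: "S \<in> Pow D"
        have "insert x D - S = insert x (D - S)" using fS[OF S] by auto
        then show "h S * ((\<Prod>y\<in>S. exceed u y) * (\<Prod>y\<in>insert x D - S. 1 - exceed u y)) = (1 - p) * h S * w S"
          using insert.hyps by (simp add: w_def p_def)
      qed
      also have "(\<Sum>S\<in>Pow D. h (insert x S) * ((\<Prod>y\<in>insert x S. exceed u y) * (\<Prod>y\<in>insert x D - insert x S. 1 - exceed u y)))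
          = (\<Sum>S\<in>Pow D. p * h (insert x S) * w S)"
      proof (intro sum.cong refl)
        fix S assume S: "S \<in> Pow D"
        have "insert x D - insert x S = D - S" using insert.hyps by auto
        then show "h (insert x S) * ((\<Prod>y\<in>insert x S. exceed u y) * (\<Prod>y\<in>insert x D - insert x S. 1 - exceed u y)) = p * h (insert x S) * w S"
          using fS[OF S] by (simp add: w_def p_def)
      qed
      finally show ?thesis by (simp add: h'_def sum.distrib[symmetric] algebra_simps)
    qed
    have IH: "\<bar>(\<integral>\<omega>. h' (HD \<omega>) \<partial>M) - (\<Sum>S\<in>Pow D. h' S * w S)\<bar> \<le> 2 * (\<Sum>x\<in>D. \<Sum>y\<in>D - {x}. exceed_cov u x y)"
      unfolding HD_def w_def by (rule insert.IH[OF DB h'01])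
    have cov: "\<bar>\<integral>\<omega>. (I \<omega> - p) * g (HD \<omega>) \<partial>M\<bar> \<le> 2 * (\<Sum>y\<in>D. exceed_cov u x y)"
      unfolding I_def p_def HD_def by (rule abs_cov_exceedance_le[OF xB DB g1])
    \<comment> \<open>Obtained from the covariance bound for the zero function. It lets the inner
      index sets grow from \<open>D\<close> to \<open>insert x D\<close>.\<close>
    have cov_nn: "exceed_cov u a b \<ge> 0" if "a \<in> B" "b \<in> B" for a b
    proof -
      have "0 \<le> 2 * (\<Sum>y\<in>{b}. exceed_cov u a y)"
        using abs_cov_exceedance_le[of a "{b}" "\<lambda>_. 0" u] that by simp
      then show ?thesis by simp
    qed
    have "(\<Sum>a\<in>D. \<Sum>y\<in>D - {a}. exceed_cov u a y) \<le> (\<Sum>a\<in>D. \<Sum>y\<in>insert x D - {a}. exceed_cov u a y)"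
      using insert.hyps DB xB by (intro sum_mono sum_mono2 cov_nn) auto
    moreover have "insert x D - {x} = D" using insert.hyps by auto
    ultimately have "2 * (\<Sum>a\<in>insert x D. \<Sum>y\<in>insert x D - {a}. exceed_cov u a y) \<ge>
       2 * (\<Sum>y\<in>D. exceed_cov u x y) + 2 * (\<Sum>a\<in>D. \<Sum>y\<in>D - {a}. exceed_cov u a y)"
      using insert.hyps by simp
    then show ?case unfolding L R using IH cov by linarith
  qed
qed

end

subsection \<open>Covariance of two exceedances\<close>

definition gtail :: "real \<Rightarrow> real" where
  "gtail t = (\<integral>x. std_normal_density x * indicator {t..} x \<partial>lborel)"

lemma integrable_gtail [simp]: "integrable lborel (\<lambda>x. std_normal_density x * indicator {t..} x)"
  using integrable_mult_indicator[of "{t..}" lborel std_normal_density] by (simp add: mult.commute)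

lemma gtail_nonneg: "gtail t \<ge> 0"
  unfolding gtail_def by (intro Bochner_Integration.integral_nonneg) auto

lemma gtail_antimono: "s \<le> t \<Longrightarrow> gtail t \<le> gtail s"
  unfolding gtail_def by (intro integral_mono integrable_gtail mult_left_mono) (auto simp: indicator_def)

text \<open>Comparison with the normal density centred at t: x^2 >= t^2 + (x - t)^2 for x >= t >=
  0.\<close>

lemma gtail_le_exp:
  assumes "t \<ge> 0"
  shows "gtail t \<le> exp (- t\<^sup>2 / 2)"
proof -
  have "gtail t \<le> (\<integral>x. exp (- t\<^sup>2 / 2) * normal_density t 1 x \<partial>lborel)"
    unfolding gtail_def
  proof (intro integral_mono integrable_gtail integrable_mult_right)
    fix x :: real
    show "std_normal_density x * indicator {t..} x \<le> exp (- t\<^sup>2 / 2) * normal_density t 1 x"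
    proof (cases "t \<le> x")
      case True
      have "0 \<le> t * (x - t)" using assms True by simp
      then have "- x\<^sup>2 / 2 \<le> - t\<^sup>2 / 2 + - (x - t)\<^sup>2 / 2" by (simp add: power2_eq_square algebra_simps)
      then have "exp (- x\<^sup>2 / 2) \<le> exp (- t\<^sup>2 / 2) * exp (- (x - t)\<^sup>2 / 2)"
        by (simp add: exp_add[symmetric] del: minus_divide_left)
      then have "exp (- x\<^sup>2 / 2) / sqrt (2 * pi) \<le> exp (- t\<^sup>2 / 2) * exp (- (x - t)\<^sup>2 / 2) / sqrt (2 * pi)"
        by (intro divide_right_mono) auto
      then show ?thesis using True by (simp add: normal_density_def)
    qed auto
  qed auto
  then show ?thesis by simp
qed

text \<open>The factor t - s is the source of the linear dependence on the Green's function for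
  distant pairs.\<close>

lemma gtail_diff_le:
  assumes "0 \<le> s" "s \<le> t"
  shows "gtail s - gtail t \<le> (t - s) * exp (- s\<^sup>2 / 2)"
proof -
  have "gtail s - gtail t = (\<integral>x. std_normal_density x * indicator {s..} x - std_normal_density x * indicator {t..} x \<partial>lborel)"
    unfolding gtail_def by simp
  also have "\<dots> \<le> (\<integral>x. exp (- s\<^sup>2 / 2) * indicator {s..t} x \<partial>lborel)"
  proof (intro integral_mono Bochner_Integration.integrable_diff integrable_gtail)
    show "integrable lborel (\<lambda>x. exp (- s\<^sup>2 / 2) * indicator {s..t} x)"
      using assms by (intro integrable_mult_right integrable_real_indicator) auto
    fix x :: real
    have "std_normal_density x \<le> exp (- s\<^sup>2 / 2)" if "s \<le> x"
    proof -
      have "1 \<le> sqrt (2 * pi)" using pi_ge_two by simp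
      then have "std_normal_density x \<le> exp (- x\<^sup>2 / 2)"
        by (simp add: std_normal_density_def divide_le_eq mult_le_cancel_left1)
      also have "\<dots> \<le> exp (- s\<^sup>2 / 2)" using assms that by (simp add: power_mono)
      finally show ?thesis .
    qed
    then show "std_normal_density x * indicator {s..} x - std_normal_density x * indicator {t..} x \<le> exp (- s\<^sup>2 / 2) * indicator {s..t} x"
      using assms by (auto simp: indicator_def)
  qed
  also have "\<dots> = (t - s) * exp (- s\<^sup>2 / 2)" using assms by simp
  finally show ?thesis .
qed

lemma (in prob_space) centred_gaussian_tail:
  assumes "centred_gaussian_rv M X v" and v: "v > 0"
  shows "(\<integral>\<omega>. indicator {u..} (X \<omega>) \<partial>M) = gtail (u / sqrt v)"
proof -
  have "distributed M lborel X (normal_density 0 (sqrt v))"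
    using assms by (auto simp: centred_gaussian_rv_def split: if_splits)
  then have D: "distributed M lborel (\<lambda>x. X x / sqrt v) std_normal_density"
    using normal_standard_normal_convert[of "sqrt v" X 0] v by simp
  have "gtail (u / sqrt v) = (\<integral>\<omega>. indicator {u / sqrt v..} (X \<omega> / sqrt v) \<partial>M)"
    unfolding gtail_def by (rule distributed_integral[OF D]) auto
  also have "\<dots> = (\<integral>\<omega>. indicator {u..} (X \<omega>) \<partial>M)"
    using v by (intro Bochner_Integration.integral_cong) (auto simp: indicator_def divide_le_cancel)
  finally show ?thesis ..
qed

section \<open>Near pairs and far pairs\<close>

context gaussian_family
begin

lemma two_point_gaussian:
  assumes "x \<in> B" "y \<in> B"
  shows "centred_gaussian_rv M (\<lambda>\<omega>. a * \<phi> x \<omega> + b * \<phi> y \<omega>) (a\<^sup>2 * K x x + 2 * a * b * kcov x y + b\<^sup>2 * K y y)"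
proof -
  \<comment> \<open>A sum of two point masses covers x = y as well, the case used in
    \<open>exceed_eq_gtail\<close>.\<close>
  define c where "c = (\<lambda>z. (if z = x then a else 0) + (if z = y then b else 0))"
  have sum_c: "(\<Sum>z\<in>B. c z * f z) = a * f x + b * f y" for f
    using assms finite_B by (simp add: c_def distrib_right sum.distrib if_distrib[of "\<lambda>c. c * _"] cong: if_cong)
  have "(\<Sum>z\<in>B. \<Sum>w\<in>B. c z * c w * K z w) = (\<Sum>z\<in>B. c z * (\<Sum>w\<in>B. c w * K z w))"
    by (simp add: sum_distrib_left mult.assoc)
  also have "\<dots> = a\<^sup>2 * K x x + 2 * a * b * kcov x y + b\<^sup>2 * K y y"
    unfolding sum_c by (simp add: kcov_def power2_eq_square algebra_simps)
  finally show ?thesis using gaussian[of c] unfolding sum_c by simp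
qed

lemma exceed_eq_gtail: "x \<in> B \<Longrightarrow> exceed u x = gtail (u / sqrt (K x x))"
  using centred_gaussian_tail[OF two_point_gaussian[of x x 1 0] , of u] K_diag_pos[of x]
  by (simp add: exceed_def)

lemma exceed_cov_le_near:
  assumes "x \<in> B" "y \<in> B" "0 \<le> u" and V: "K x x + K y y + 2 * kcov x y \<le> V"
  shows "exceed_cov u x y \<le> exp (- 2 * u\<^sup>2 / V)"
proof -
  define v where "v = K x x + K y y + 2 * kcov x y"
  have v: "v > 0" using K_diag_pos[of x] K_diag_pos[of y] kcov_nonneg[of x y] assms by (simp add: v_def)
  have g: "centred_gaussian_rv M (\<lambda>\<omega>. \<phi> x \<omega> + \<phi> y \<omega>) v"
    using two_point_gaussian[OF assms(1,2), of 1 1] by (simp add: v_def algebra_simps)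
  have "exceed u x * exceed u y \<ge> 0" using assms by (simp add: exceed_eq_gtail gtail_nonneg)
  then have "exceed_cov u x y \<le> (\<integral>\<omega>. indicator {u..} (\<phi> x \<omega>) * indicator {u..} (\<phi> y \<omega>) \<partial>M)"
    by (simp add: exceed_cov_def)
  also have "\<dots> \<le> (\<integral>\<omega>. indicator {2 * u..} (\<phi> x \<omega> + \<phi> y \<omega>) \<partial>M)"
    by (intro integral_mono integrable_bounded_mult[where B = 1 and C = 1] integrable_const_bound[where B = 1])
      (auto simp: indicator_def)
  also have "\<dots> = gtail (2 * u / sqrt v)" by (rule centred_gaussian_tail[OF g v])
  also have "\<dots> \<le> exp (- ((2 * u / sqrt v)\<^sup>2 / 2))" using gtail_le_exp[of "2 * u / sqrt v"] assms v by simp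
  also have "(2 * u / sqrt v)\<^sup>2 / 2 = 2 * u\<^sup>2 / v" using v by (simp add: power_divide)
  also have "exp (- (2 * u\<^sup>2 / v)) \<le> exp (- (2 * u\<^sup>2 / V))"
    using v V by (simp add: v_def frac_le)
  finally show ?thesis by simp
qed

text \<open>Resample the value at x. Either it exceeds 2 u, which costs exp(-2 u^2 / V), or it adds
  at most 2 b u at y and the residual must exceed u - 2 b u. Residual and fresh value are
  independent, so subtracting the product leaves a difference of two tails, of order b u. In the
  exponent, 1 comes from the event at x and (1 - 2 \<epsilon>)^2 from the lowered level at
  y.\<close>

lemma exceed_cov_le_far:
  assumes x: "x \<in> B" and y: "y \<in> B" and u: "0 \<le> u"
    and K1: "1 \<le> K x x" "1 \<le> K y y" and KV: "K x x \<le> V" "K y y \<le> V"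
    and C: "kcov x y \<le> \<epsilon>" and \<epsilon>: "\<epsilon> \<le> 1 / 4"
  shows "exceed_cov u x y \<le> exp (- 2 * u\<^sup>2 / V)
    + 4 * kcov x y * u * exp (- (1 + (1 - 2 * \<epsilon>)\<^sup>2) * u\<^sup>2 / (2 * V))"
proof -
  define b where "b = \<beta> x y"
  define \<tau>2 where "\<tau>2 = K y y - b * kcov x y"
  have C0: "0 \<le> kcov x y" using kcov_nonneg[OF x y] .
  have b0: "0 \<le> b" using \<beta>_nonneg[OF x y] by (simp add: b_def)
  have bC: "b \<le> kcov x y" using K1 C0 by (simp add: b_def \<beta>_def divide_le_eq mult_le_cancel_left1)
  have b\<epsilon>: "b \<le> \<epsilon>" using bC C by linarith
  have bb: "b * kcov x y \<le> 1/4 * (1/4)" using b\<epsilon> C \<epsilon> b0 C0 by (intro mult_mono) auto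
  have \<tau>2: "1/4 \<le> \<tau>2" "\<tau>2 \<le> K y y" "\<tau>2 \<le> V" using bb b0 C0 K1 KV by (auto simp: \<tau>2_def) (smt (verit) mult_nonneg_nonneg)
  have V1: "1 \<le> V" using K1 KV by linarith
  have g\<psi>: "centred_gaussian_rv M (\<lambda>a. \<phi> y a - b * \<phi> x a) \<tau>2"
  proof -
    have "(- b)\<^sup>2 * K x x + 2 * (- b) * 1 * kcov x y + 1\<^sup>2 * K y y = \<tau>2"
      using K1 by (simp add: \<tau>2_def b_def \<beta>_def power2_eq_square field_simps)
    then show ?thesis using two_point_gaussian[OF x y, of "- b" 1] by simp
  qed
  have "(\<integral>\<omega>. indicator {u..} (\<phi> x \<omega>) * indicator {u..} (\<phi> y \<omega>) \<partial>M)
      = (\<integral>\<omega>. (of_bool (x \<in> {z \<in> B. u \<le> \<phi> z \<omega>}) * of_bool (y \<in> {z \<in> B. u \<le> \<phi> z \<omega>}) :: real) \<partial>M)"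
    using x y by (intro Bochner_Integration.integral_cong) auto
  also have "\<dots> = (\<integral>z. of_bool (x \<in> {w \<in> B. u \<le> resampled x w z}) * of_bool (y \<in> {w \<in> B. u \<le> resampled x w z}) \<partial>(M \<Otimes>\<^sub>M M))"
    by (rule resampled_law[OF x, of "\<lambda>S. of_bool (x \<in> S) * of_bool (y \<in> S)"])
  also have "\<dots> = (\<integral>z. indicator {u..} (resampled x x z) * indicator {u..} (resampled x y z) \<partial>(M \<Otimes>\<^sub>M M))"
    using x y by (intro Bochner_Integration.integral_cong) auto
  also have "\<dots> \<le> (\<integral>z. indicator {2 * u..} (\<phi> x (snd z))
      + indicator {u - 2 * b * u..} (\<phi> y (fst z) - b * \<phi> x (fst z)) * indicator {u..} (\<phi> x (snd z)) \<partial>(M \<Otimes>\<^sub>M M))"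
  proof -
    interpret N: prob_space "M \<Otimes>\<^sub>M M" by (rule prob_space_pair)
    show ?thesis
    proof (intro integral_mono)
      show "integrable (M \<Otimes>\<^sub>M M) (\<lambda>z. indicator {u..} (resampled x x z) * indicator {u..} (resampled x y z) :: real)"
        by (intro N.integrable_bounded_mult[where B = 1 and C = 1]) auto
      show "integrable (M \<Otimes>\<^sub>M M) (\<lambda>z. indicator {2 * u..} (\<phi> x (snd z))
          + indicator {u - 2 * b * u..} (\<phi> y (fst z) - b * \<phi> x (fst z)) * indicator {u..} (\<phi> x (snd z)) :: real)"
        by (intro N.integrable_const_bound[where B = 2]) (auto simp: indicator_def)
      fix z :: "'a \<times> 'a"
      obtain a c where z: "z = (a, c)" by force
      have "u - 2 * b * u \<le> \<phi> y a - b * \<phi> x a" if "\<phi> x c \<le> 2 * u" "u \<le> resampled x y (a, c)"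
      proof -
        have "b * \<phi> x c \<le> b * (2 * u)" using that b0 by (intro mult_left_mono)
        then show ?thesis using that by (simp add: resampled_def b_def)
      qed
      then show "indicator {u..} (resampled x x z) * indicator {u..} (resampled x y z) \<le> indicator {2 * u..} (\<phi> x (snd z))
          + indicator {u - 2 * b * u..} (\<phi> y (fst z) - b * \<phi> x (fst z)) * (indicator {u..} (\<phi> x (snd z)) :: real)"
        unfolding z resampled_self[OF x] by (auto simp: indicator_def)
    qed
  qed
  also have "\<dots> = (\<integral>a. \<integral>c. indicator {2 * u..} (\<phi> x c)
      + indicator {u - 2 * b * u..} (\<phi> y a - b * \<phi> x a) * indicator {u..} (\<phi> x c) \<partial>M \<partial>M)"
    by (subst pair_integral_eq_iterated[where c = 2]) (auto simp: indicator_def)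
  also have "\<dots> = (\<integral>a. exceed (2 * u) x + indicator {u - 2 * b * u..} (\<phi> y a - b * \<phi> x a) * exceed u x \<partial>M)"
  proof -
    have i: "integrable M (\<lambda>c. indicator {s..} (\<phi> x c) :: real)" for s
      by (intro integrable_const_bound[where B = 1]) auto
    show ?thesis using i by (simp add: exceed_def)
  qed
  also have "\<dots> = exceed (2 * u) x + gtail ((u - 2 * b * u) / sqrt \<tau>2) * exceed u x"
  proof -
    have i: "integrable M (\<lambda>a. indicator {u - 2 * b * u..} (\<phi> y a - b * \<phi> x a) :: real)"
      by (intro integrable_const_bound[where B = 1]) auto
    have "(\<integral>a. indicator {u - 2 * b * u..} (\<phi> y a - b * \<phi> x a) \<partial>M) = gtail ((u - 2 * b * u) / sqrt \<tau>2)"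
      using \<tau>2 by (intro centred_gaussian_tail[OF g\<psi>]) auto
    then show ?thesis using i by (simp add: prob_space)
  qed
  finally have 1: "exceed_cov u x y \<le> exceed (2 * u) x + exceed u x * (gtail ((u - 2 * b * u) / sqrt \<tau>2) - exceed u y)"
    by (simp add: exceed_cov_def algebra_simps)
  have exc: "exceed s x \<le> exp (- s\<^sup>2 / (2 * V))" if "s \<ge> 0" for s
  proof -
    have "exceed s x \<le> exp (- ((s / sqrt (K x x))\<^sup>2 / 2))"
      unfolding exceed_eq_gtail[OF x] using gtail_le_exp[of "s / sqrt (K x x)"] that K1 by simp
    also have "(s / sqrt (K x x))\<^sup>2 / 2 = s\<^sup>2 / (2 * K x x)" using K1 by (simp add: power_divide)
    also have "exp (- (s\<^sup>2 / (2 * K x x))) \<le> exp (- (s\<^sup>2 / (2 * V)))"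
      using K1 KV by (simp add: frac_le)
    finally show ?thesis by simp
  qed
  have u1: "0 \<le> (1 - 2 * \<epsilon>) * u" "(1 - 2 * \<epsilon>) * u \<le> u - 2 * b * u" "u - 2 * b * u \<le> u"
  proof -
    have "b * u \<le> \<epsilon> * u" "\<epsilon> * u \<le> 1/4 * u" "0 \<le> b * u"
      using mult_right_mono[OF b\<epsilon> u] mult_right_mono[OF \<epsilon> u] b0 u by auto
    then show "0 \<le> (1 - 2 * \<epsilon>) * u" "(1 - 2 * \<epsilon>) * u \<le> u - 2 * b * u" "u - 2 * b * u \<le> u"
      using u by (simp_all add: algebra_simps)
  qed
  \<comment> \<open>Since \<open>\<tau>2\<close> is at most \<open>K y y\<close>, rescaling the
    subtracted tail by \<open>\<tau>2\<close> only lowers it, and both tails then have the same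
    scale.\<close>
  have "gtail ((u - 2 * b * u) / sqrt \<tau>2) - exceed u y \<le> gtail ((u - 2 * b * u) / sqrt \<tau>2) - gtail (u / sqrt \<tau>2)"
    unfolding exceed_eq_gtail[OF y] using u \<tau>2 by (intro diff_left_mono gtail_antimono divide_left_mono) auto
  also have "\<dots> \<le> (u / sqrt \<tau>2 - (u - 2 * b * u) / sqrt \<tau>2) * exp (- ((u - 2 * b * u) / sqrt \<tau>2)\<^sup>2 / 2)"
    using u1 \<tau>2 by (intro gtail_diff_le divide_right_mono) auto
  also have "\<dots> \<le> (4 * kcov x y * u) * exp (- ((1 - 2 * \<epsilon>)\<^sup>2 * u\<^sup>2 / (2 * V)))"
  proof (intro mult_mono)
    \<comment> \<open>One factor 2 of the constant 4 comes from here, the other from 2 b u.\<close>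
    have s: "1/2 \<le> sqrt \<tau>2" using \<tau>2 by (intro real_le_rsqrt) (auto simp: power2_eq_square)
    have "u / sqrt \<tau>2 - (u - 2 * b * u) / sqrt \<tau>2 = (2 * b * u) / sqrt \<tau>2" by (simp add: diff_divide_distrib)
    also have "\<dots> \<le> (2 * b * u) / (1/2)" using b0 u s \<tau>2 by (intro divide_left_mono) auto
    also have "\<dots> \<le> 4 * kcov x y * u" using bC u by (simp add: mult_right_mono)
    finally show "u / sqrt \<tau>2 - (u - 2 * b * u) / sqrt \<tau>2 \<le> 4 * kcov x y * u" .
    have "((1 - 2 * \<epsilon>) * u)\<^sup>2 / (2 * V) \<le> (u - 2 * b * u)\<^sup>2 / (2 * \<tau>2)"
      using u1 \<tau>2 by (intro frac_le power_mono) auto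
    then show "exp (- ((u - 2 * b * u) / sqrt \<tau>2)\<^sup>2 / 2) \<le> exp (- ((1 - 2 * \<epsilon>)\<^sup>2 * u\<^sup>2 / (2 * V)))"
      using \<tau>2 by (simp add: power_divide power_mult_distrib)
  qed (use C0 u in auto)
  finally have 2: "gtail ((u - 2 * b * u) / sqrt \<tau>2) - exceed u y \<le> (4 * kcov x y * u) * exp (- ((1 - 2 * \<epsilon>)\<^sup>2 * u\<^sup>2 / (2 * V)))" .
  have "exceed u x * (gtail ((u - 2 * b * u) / sqrt \<tau>2) - exceed u y)
      \<le> exceed u x * ((4 * kcov x y * u) * exp (- ((1 - 2 * \<epsilon>)\<^sup>2 * u\<^sup>2 / (2 * V))))"
    using 2 by (intro mult_left_mono) (auto simp: exceed_eq_gtail[OF x] gtail_nonneg)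
  also have "\<dots> \<le> exp (- u\<^sup>2 / (2 * V)) * ((4 * kcov x y * u) * exp (- ((1 - 2 * \<epsilon>)\<^sup>2 * u\<^sup>2 / (2 * V))))"
    using exc[OF u] C0 u by (intro mult_right_mono) auto
  also have "\<dots> = 4 * kcov x y * u * exp (- (1 + (1 - 2 * \<epsilon>)\<^sup>2) * u\<^sup>2 / (2 * V))"
  proof -
    have "- (1 + (1 - 2 * \<epsilon>)\<^sup>2) * u\<^sup>2 / (2 * V) = - u\<^sup>2 / (2 * V) + - ((1 - 2 * \<epsilon>)\<^sup>2 * u\<^sup>2 / (2 * V))"
      using V1 by (simp add: field_simps)
    then show ?thesis by (simp only: exp_add) simp
  qed
  finally have 3: "exceed u x * (gtail ((u - 2 * b * u) / sqrt \<tau>2) - exceed u y)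
      \<le> 4 * kcov x y * u * exp (- (1 + (1 - 2 * \<epsilon>)\<^sup>2) * u\<^sup>2 / (2 * V))" .
  have "exceed (2 * u) x \<le> exp (- 2 * u\<^sup>2 / V)" using exc[of "2 * u"] u by (simp add: power_mult_distrib)
  then show ?thesis using 1 3 by linarith
qed

end

subsection \<open>High points of the free field\<close>

lemma card_box_int_le: "card (box_int n :: (int ^ 'd::finite) set) \<le> n ^ CARD('d)"
proof -
  have "card (box_int n :: (int ^ 'd) set) \<le> nat (int n - 1) ^ CARD('d)"
    using card_vec_box_le(2)[of "\<lambda>_::'d. {0<..<int n}"] by (simp add: box_int_def)
  also have "\<dots> \<le> n ^ CARD('d)" by (intro power_mono) auto
  finally show ?thesis .
qed

lemma card_near_le:
  "finite {y :: int ^ 'd::finite. \<forall>i. \<bar>x $ i - y $ i\<bar> \<le> int r}"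
  "card {y :: int ^ 'd::finite. \<forall>i. \<bar>x $ i - y $ i\<bar> \<le> int r} \<le> (2 * r + 1) ^ CARD('d)"
proof -
  have eq: "{y :: int ^ 'd. \<forall>i. \<bar>x $ i - y $ i\<bar> \<le> int r} = {y. \<forall>i. y $ i \<in> {x $ i - int r..x $ i + int r}}"
    by (intro Collect_cong all_cong1) auto
  show "finite {y :: int ^ 'd. \<forall>i. \<bar>x $ i - y $ i\<bar> \<le> int r}"
    unfolding eq by (rule card_vec_box_le) auto
  show "card {y :: int ^ 'd. \<forall>i. \<bar>x $ i - y $ i\<bar> \<le> int r} \<le> (2 * r + 1) ^ CARD('d)"
    unfolding eq using card_vec_box_le(2)[of "\<lambda>i. {x $ i - int r..x $ i + int r}"]
    by (simp add: nat_add_distrib nat_mult_distrib)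
qed

lemma bulk_subset_box_int:
  assumes "0 < \<delta>" "n > 0"
  shows "bulk \<delta> n \<subseteq> box_int n"
proof
  fix x :: "int ^ 'a" assume x: "x \<in> bulk \<delta> n"
  have "0 < x $ i \<and> x $ i < int n" for i
  proof -
    have 1: "\<delta> * real n \<le> real_of_int (x $ i)" "real_of_int (x $ i) \<le> (1 - \<delta>) * real n"
      using x by (auto simp: bulk_def)
    have "0 < \<delta> * real n" using assms by simp
    then have "0 < real_of_int (x $ i)" "real_of_int (x $ i) < real n"
      using 1 by (auto simp: algebra_simps)
    then show ?thesis by linarith
  qed
  then show "x \<in> box_int n" by (simp add: box_int_def)
qed

lemma dgff_gaussian_family:
  fixes \<phi> :: "int ^ 'd::finite \<Rightarrow> 'a \<Rightarrow> real"
  assumes d3: "CARD('d) \<ge> 3" and dgff: "is_dgff n M \<phi>"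
  shows "gaussian_family M (box_int n) (green_box n) \<phi>"
proof -
  interpret prob_space M using dgff by (simp add: is_dgff_def)
  have g: "centred_gaussian_rv M (\<lambda>\<omega>. \<Sum>x\<in>box_int n. c x * \<phi> x \<omega>)
          (\<Sum>x\<in>box_int n. \<Sum>y\<in>box_int n. c x * c y * green_box n x y)" for c
    using dgff by (simp add: is_dgff_def)
  show ?thesis
  proof
    fix x
    show "\<phi> x \<in> borel_measurable M"
    proof (cases "x \<in> box_int n")
      case True
      have "(\<lambda>\<omega>. \<Sum>z\<in>box_int n. (if z = x then 1 else 0) * \<phi> z \<omega>) \<in> borel_measurable M"
        using g[of "\<lambda>z. if z = x then 1 else 0"] unfolding centred_gaussian_rv_def by blast
      then show ?thesis using True by (simp add: if_distrib[of "\<lambda>c. c * _"] cong: if_cong)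
    next
      case False
      then have "\<phi> x = (\<lambda>_. 0)" using dgff by (auto simp: is_dgff_def)
      then show ?thesis by simp
    qed
  qed (use g green_box_nonneg[OF d3] green_box_diag_ge_1[OF d3] in \<open>auto intro: less_le_trans[OF zero_less_one]\<close>)
qed

lemma tv_high_le_cov:
  fixes \<phi> :: "int ^ 'd::finite \<Rightarrow> 'a \<Rightarrow> real" and \<alpha> :: real
  assumes gf: "gaussian_family M (box_int n) K \<phi>" and "0 < \<delta>" "n > 0"
  defines "u \<equiv> hp_level TYPE('d) \<alpha> n"
  shows "0 \<le> tv_high M \<delta> \<alpha> n \<phi>"
    and "tv_high M \<delta> \<alpha> n \<phi> \<le> 2 * (\<Sum>x\<in>bulk \<delta> n. \<Sum>y\<in>bulk \<delta> n - {x}. gaussian_family.exceed_cov M \<phi> u x y)"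
proof -
  interpret gaussian_family M "box_int n" K \<phi> by fact
  let ?D = "bulk \<delta> n :: (int ^ 'd) set"
  have DB: "?D \<subseteq> box_int n" using assms by (intro bulk_subset_box_int) auto
  have finD: "finite ?D" using DB finite_box_int by (rule finite_subset)
  have p: "measure M {\<omega> \<in> space M. u \<le> \<phi> x \<omega>} = exceed u x" for x
  proof -
    have "measure M {\<omega> \<in> space M. u \<le> \<phi> x \<omega>} = (\<integral>\<omega>. indicator {\<omega> \<in> space M. u \<le> \<phi> x \<omega>} \<omega> \<partial>M)" by simp
    also have "\<dots> = exceed u x" unfolding exceed_def
      by (intro Bochner_Integration.integral_cong) (auto simp: indicator_def)
    finally show ?thesis .
  qed
  have bound: "\<bar>measure M {\<omega> \<in> space M. high_points \<delta> \<alpha> n \<phi> \<omega> \<in> A} - bern_law M \<delta> \<alpha> n \<phi> A\<bar>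
     \<le> 2 * (\<Sum>x\<in>?D. \<Sum>y\<in>?D - {x}. exceed_cov u x y)" for A
  proof -
    define h :: "(int ^ 'd) set \<Rightarrow> real" where "h = (\<lambda>S. of_bool (S \<in> A))"
    have hp: "high_points \<delta> \<alpha> n \<phi> \<omega> = {y \<in> ?D. u \<le> \<phi> y \<omega>}" for \<omega>
      by (auto simp: high_points_def u_def)
    have hm: "(\<lambda>\<omega>. h {y \<in> ?D. u \<le> \<phi> y \<omega>}) \<in> borel_measurable M"
      by (rule measurable_set_fun[OF finD]) auto
    have meas: "{\<omega> \<in> space M. {y \<in> ?D. u \<le> \<phi> y \<omega>} \<in> A} \<in> sets M"
    proof -
      have "{\<omega> \<in> space M. {y \<in> ?D. u \<le> \<phi> y \<omega>} \<in> A} = (\<lambda>\<omega>. h {y \<in> ?D. u \<le> \<phi> y \<omega>}) -` {1} \<inter> space M"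
        by (auto simp: h_def)
      then show ?thesis using measurable_sets[OF hm, of "{1}"] by simp
    qed
    have "measure M {\<omega> \<in> space M. high_points \<delta> \<alpha> n \<phi> \<omega> \<in> A}
        = (\<integral>\<omega>. indicator {\<omega> \<in> space M. {y \<in> ?D. u \<le> \<phi> y \<omega>} \<in> A} \<omega> \<partial>M)"
      unfolding hp using meas by simp
    also have "\<dots> = (\<integral>\<omega>. h {y \<in> ?D. u \<le> \<phi> y \<omega>} \<partial>M)"
      by (intro Bochner_Integration.integral_cong) (auto simp: h_def)
    finally have 1: "measure M {\<omega> \<in> space M. high_points \<delta> \<alpha> n \<phi> \<omega> \<in> A} = (\<integral>\<omega>. h {y \<in> ?D. u \<le> \<phi> y \<omega>} \<partial>M)" .
    have "bern_law M \<delta> \<alpha> n \<phi> A = (\<Sum>S\<in>A \<inter> Pow ?D. (\<Prod>x\<in>S. exceed u x) * (\<Prod>x\<in>?D - S. 1 - exceed u x))"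
      by (simp add: bern_law_def Let_def u_def[symmetric] p)
    also have "\<dots> = (\<Sum>S\<in>Pow ?D. h S * ((\<Prod>y\<in>S. exceed u y) * (\<Prod>y\<in>?D - S. 1 - exceed u y)))"
      using finD by (intro sum.mono_neutral_cong_left) (auto simp: h_def)
    finally have 2: "bern_law M \<delta> \<alpha> n \<phi> A = \<dots>" .
    show ?thesis unfolding 1 2 by (rule tv_exceedance_le[OF DB]) (simp add: h_def)
  qed
  have fin: "finite (Pow (Pow ?D))" using finD by simp
  show "tv_high M \<delta> \<alpha> n \<phi> \<le> 2 * (\<Sum>x\<in>?D. \<Sum>y\<in>?D - {x}. exceed_cov u x y)"
    unfolding tv_high_def using fin bound by (subst Max_le_iff) auto
  show "0 \<le> tv_high M \<delta> \<alpha> n \<phi>"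
    unfolding tv_high_def using fin by (subst Max_ge_iff) auto
qed

text \<open>The three terms are n^d points with boundedly many near partners, at most n^(2 d) pairs
  whose resampled value exceeds 2 u, and the linear term, for which the covariances sum to at most d
  n^(d + 2). The level is calibrated by \<open>V\<close>, which bounds all variances, so
  \<open>exp_u\<close> turns each exponential into a power of n.\<close>

lemma tv_high_le:
  fixes \<phi> :: "int ^ 'd::finite \<Rightarrow> 'a \<Rightarrow> real"
  assumes d3: "CARD('d) \<ge> 3" and dgff: "is_dgff n M \<phi>" and \<delta>: "0 < \<delta>" and n: "n \<ge> 2" and \<alpha>: "0 < \<alpha>"
    and \<epsilon>: "0 < \<epsilon>" "\<epsilon> \<le> 1/4"
    and r: "\<And>(x :: int ^ 'd) y. \<exists>i. \<bar>x $ i - y $ i\<bar> > int r \<Longrightarrow> green_box n x y \<le> \<epsilon>"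
  defines "d \<equiv> real CARD('d)" and "\<rho> \<equiv> hit_ratio TYPE('d)"
  shows "tv_high M \<delta> \<alpha> n \<phi> \<le> 2 * (real ((2 * r + 1) ^ CARD('d)) * real n powr (d - 2 * \<alpha> * d / (1 + \<rho>))
     + real n powr (2 * d - 4 * \<alpha> * d)
     + 4 * d * hp_level TYPE('d) \<alpha> n * real n powr (d + 2 - \<alpha> * d * (1 + (1 - 2 * \<epsilon>)\<^sup>2)))"
proof -
  interpret gaussian_family M "box_int n" "green_box n" \<phi> by (rule dgff_gaussian_family[OF d3 dgff])
  let ?D = "bulk \<delta> n :: (int ^ 'd) set"
  define V where "V = green0 TYPE('d)"
  define u where "u = hp_level TYPE('d) \<alpha> n"
  have DB: "?D \<subseteq> box_int n" using \<delta> n by (intro bulk_subset_box_int) auto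
  have finD: "finite ?D" using DB finite_box_int by (rule finite_subset)
  have K1: "1 \<le> green_box n x x" and KV: "green_box n x x \<le> V" for x :: "int ^ 'd"
    using green_box_diag_ge_1[OF d3] green_box_diag_le_green0[OF d3] by (auto simp: V_def)
  have V1: "1 \<le> V" using K1[of 0] KV[of 0] by linarith
  have \<rho>: "0 < \<rho>" "\<rho> < 1" using hit_ratio_bounds[OF d3] by (auto simp: \<rho>_def)
  have d0: "0 < d" by (simp add: d_def)
  have lnn: "ln (real n) \<ge> 0" using n by simp
  have u0: "0 \<le> u" and u2: "u\<^sup>2 = 2 * \<alpha> * d * V * ln (real n)"
    using \<alpha> d0 V1 lnn by (auto simp: u_def hp_level_def V_def d_def)
  have exp_u: "exp (- c * u\<^sup>2 / (2 * V)) = real n powr (- c * \<alpha> * d)" for c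
  proof -
    have "- c * u\<^sup>2 / (2 * V) = (- c * \<alpha> * d) * ln (real n)" using V1 by (simp add: u2)
    then show ?thesis using n by (simp add: powr_def)
  qed
  \<comment> \<open>These are \<open>exp_u\<close> at c = 2 / (1 + \<rho>), at c = 4 and, with the
    factor 4 u, at c = 1 + (1 - 2 \<epsilon>)^2.\<close>
  define N1 where "N1 = real n powr (- 2 * \<alpha> * d / (1 + \<rho>))"
  define N2 where "N2 = real n powr (- 4 * \<alpha> * d)"
  define N3 where "N3 = 4 * u * real n powr (- (1 + (1 - 2 * \<epsilon>)\<^sup>2) * \<alpha> * d)"
  have N: "0 \<le> N1" "0 \<le> N2" "0 \<le> N3" using u0 by (auto simp: N1_def N2_def N3_def)
  define near where "near = (\<lambda>x :: int ^ 'd. {y. \<forall>i. \<bar>x $ i - y $ i\<bar> \<le> int r})"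
  have cov: "exceed_cov u x y \<le> (if y \<in> near x then N1 else 0) + (N2 + N3 * kcov x y)"
    if x: "x \<in> box_int n" and y: "y \<in> box_int n" and ne: "x \<noteq> y" for x y
  proof (cases "y \<in> near x")
    case True
    have "green_box n x y \<le> \<rho> * V" "green_box n y x \<le> \<rho> * V"
      using green_box_le_hit_ratio[OF d3 ne, of n] green_box_le_hit_ratio[OF d3 ne[symmetric], of n]
        mult_left_mono[OF KV, of \<rho>] \<rho> unfolding \<rho>_def by (meson less_imp_le order_trans)+
    then have "green_box n x x + green_box n y y + 2 * kcov x y \<le> 2 * V * (1 + \<rho>)"
    proof -
      have "2 * kcov x y = green_box n x y + green_box n y x" by (simp add: kcov_def)
      moreover have "2 * V * (1 + \<rho>) = 2 * V + 2 * (\<rho> * V)" by (simp add: algebra_simps)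
      ultimately show ?thesis
        using KV[of x] KV[of y] \<open>green_box n x y \<le> \<rho> * V\<close> \<open>green_box n y x \<le> \<rho> * V\<close> by linarith
    qed
    then have "exceed_cov u x y \<le> exp (- 2 * u\<^sup>2 / (2 * V * (1 + \<rho>)))"
      by (rule exceed_cov_le_near[OF x y u0])
    also have "- 2 * u\<^sup>2 / (2 * V * (1 + \<rho>)) = - (2 / (1 + \<rho>)) * u\<^sup>2 / (2 * V)" using \<rho> V1 by simp
    also have "exp \<dots> = N1" unfolding exp_u N1_def by simp
    finally show ?thesis using True N kcov_nonneg[OF x y] by (simp add: add_increasing2)
  next
    case False
    then have "\<exists>i. \<bar>x $ i - y $ i\<bar> > int r" "\<exists>i. \<bar>y $ i - x $ i\<bar> > int r"
      by (auto simp: near_def not_le abs_minus_commute)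
    then have "kcov x y \<le> \<epsilon>" using r[of x y] r[of y x] by (simp add: kcov_def)
    then have "exceed_cov u x y \<le> exp (- 2 * u\<^sup>2 / V) + 4 * kcov x y * u * exp (- (1 + (1 - 2 * \<epsilon>)\<^sup>2) * u\<^sup>2 / (2 * V))"
      by (intro exceed_cov_le_far[OF x y u0 K1 K1 KV KV] \<epsilon>)
    also have "- 2 * u\<^sup>2 / V = - 4 * u\<^sup>2 / (2 * V)" by simp
    finally show ?thesis using False unfolding exp_u by (simp add: N2_def N3_def mult_ac)
  qed
  have cardD: "real (card ?D) \<le> real n powr d"
  proof -
    have "card ?D \<le> n ^ CARD('d)"
      using card_mono[OF finite_box_int DB] card_box_int_le[of n, where 'd = 'd] by linarith
    then have "real (card ?D) \<le> real (n ^ CARD('d))" by linarith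
    also have "\<dots> = real n powr d" using n by (simp add: d_def powr_realpow)
    finally show ?thesis .
  qed
  have near_sum: "(\<Sum>y\<in>?D. if y \<in> near x then N1 else 0) \<le> real ((2 * r + 1) ^ CARD('d)) * N1" for x
  proof -
    have "(\<Sum>y\<in>?D. if y \<in> near x then N1 else 0) = real (card (?D \<inter> near x)) * N1"
      using finD by (simp add: sum.If_cases)
    also have "card (?D \<inter> near x) \<le> card (near x)"
      using card_near_le(1)[of x r] by (intro card_mono) (auto simp: near_def)
    also have "\<dots> \<le> (2 * r + 1) ^ CARD('d)" unfolding near_def by (rule card_near_le(2))
    finally show ?thesis using N by (simp add: mult_right_mono)
  qed
  have C_sum: "(\<Sum>x\<in>?D. \<Sum>y\<in>?D. kcov x y) \<le> real n powr d * (d * (real n)\<^sup>2)"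
  proof -
    have "(\<Sum>x\<in>?D. \<Sum>y\<in>?D. kcov x y) = (\<Sum>x\<in>?D. \<Sum>y\<in>?D. green_box n x y)"
    proof -
      have "(\<Sum>x\<in>?D. \<Sum>y\<in>?D. green_box n y x) = (\<Sum>x\<in>?D. \<Sum>y\<in>?D. green_box n x y)"
        by (rule sum.swap)
      then show ?thesis by (simp add: kcov_def sum_divide_distrib[symmetric] sum.distrib)
    qed
    also have "\<dots> \<le> (\<Sum>x\<in>?D. d * (real n)\<^sup>2)"
    proof (rule sum_mono)
      fix x assume x: "x \<in> ?D"
      have "(\<Sum>y\<in>?D. green_box n x y) \<le> (\<Sum>y\<in>box_int n. green_box n x y)"
        using DB by (intro sum_mono2 green_box_nonneg d3) auto
      also have "\<dots> \<le> d * (real n)\<^sup>2" unfolding d_def using x DB by (intro sum_green_box_le d3) auto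
      finally show "(\<Sum>y\<in>?D. green_box n x y) \<le> d * (real n)\<^sup>2" .
    qed
    also have "\<dots> = real (card ?D) * (d * (real n)\<^sup>2)" by simp
    also have "\<dots> \<le> real n powr d * (d * (real n)\<^sup>2)" using cardD d0 by (intro mult_right_mono) auto
    finally show ?thesis .
  qed
  have "(\<Sum>x\<in>?D. \<Sum>y\<in>?D - {x}. exceed_cov u x y)
      \<le> (\<Sum>x\<in>?D. \<Sum>y\<in>?D - {x}. (if y \<in> near x then N1 else 0) + (N2 + N3 * kcov x y))"
    using DB by (intro sum_mono cov) auto
  also have "\<dots> \<le> (\<Sum>x\<in>?D. \<Sum>y\<in>?D. (if y \<in> near x then N1 else 0) + (N2 + N3 * kcov x y))"
    using DB finD N by (intro sum_mono sum_mono2) (auto intro!: add_nonneg_nonneg mult_nonneg_nonneg kcov_nonneg green_box_nonneg[OF d3])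
  also have "\<dots> = (\<Sum>x\<in>?D. \<Sum>y\<in>?D. if y \<in> near x then N1 else 0) + real (card ?D) * (real (card ?D) * N2)
      + N3 * (\<Sum>x\<in>?D. \<Sum>y\<in>?D. kcov x y)"
    by (simp only: sum.distrib sum_distrib_left sum_constant add.assoc)
  also have "\<dots> \<le> real n powr d * (real ((2 * r + 1) ^ CARD('d)) * N1) + real n powr d * (real n powr d * N2)
      + N3 * (real n powr d * (d * (real n)\<^sup>2))"
  proof (intro add_mono)
    have "(\<Sum>x\<in>?D. \<Sum>y\<in>?D. if y \<in> near x then N1 else 0) \<le> (\<Sum>x\<in>?D. real ((2 * r + 1) ^ CARD('d)) * N1)"
      by (intro sum_mono near_sum)
    also have "\<dots> = real (card ?D) * (real ((2 * r + 1) ^ CARD('d)) * N1)" by simp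
    also have "\<dots> \<le> real n powr d * (real ((2 * r + 1) ^ CARD('d)) * N1)" using cardD N by (intro mult_right_mono) auto
    finally show "(\<Sum>x\<in>?D. \<Sum>y\<in>?D. if y \<in> near x then N1 else 0) \<le> real n powr d * (real ((2 * r + 1) ^ CARD('d)) * N1)" .
    show "real (card ?D) * (real (card ?D) * N2) \<le> real n powr d * (real n powr d * N2)"
      using cardD N by (intro mult_mono) auto
    show "N3 * (\<Sum>x\<in>?D. \<Sum>y\<in>?D. kcov x y) \<le> N3 * (real n powr d * (d * (real n)\<^sup>2))"
      using C_sum N by (intro mult_left_mono)
  qed
  also have "real n powr d * (real ((2 * r + 1) ^ CARD('d)) * N1)
      = real ((2 * r + 1) ^ CARD('d)) * real n powr (d - 2 * \<alpha> * d / (1 + \<rho>))"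
    by (simp add: N1_def powr_diff powr_minus field_simps)
  also have "real n powr d * (real n powr d * N2) = real n powr (2 * d - 4 * \<alpha> * d)"
    by (simp add: N2_def powr_add[symmetric])
  also have "N3 * (real n powr d * (d * (real n)\<^sup>2))
      = 4 * d * u * real n powr (d + 2 - \<alpha> * d * (1 + (1 - 2 * \<epsilon>)\<^sup>2))"
  proof -
    have "(real n)\<^sup>2 = real n powr 2" using n by (simp add: powr_numeral)
    moreover have "d + 2 - \<alpha> * d * (1 + (1 - 2 * \<epsilon>)\<^sup>2) = - (1 + (1 - 2 * \<epsilon>)\<^sup>2) * \<alpha> * d + d + 2"
      by (simp add: algebra_simps)
    ultimately show ?thesis by (simp only: N3_def powr_add) simp
  qed
  finally have le: "(\<Sum>x\<in>?D. \<Sum>y\<in>?D - {x}. exceed_cov u x y)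
      \<le> real ((2 * r + 1) ^ CARD('d)) * real n powr (d - 2 * \<alpha> * d / (1 + \<rho>))
        + real n powr (2 * d - 4 * \<alpha> * d) + 4 * d * u * real n powr (d + 2 - \<alpha> * d * (1 + (1 - 2 * \<epsilon>)\<^sup>2))" .
  have "tv_high M \<delta> \<alpha> n \<phi> \<le> 2 * (\<Sum>x\<in>?D. \<Sum>y\<in>?D - {x}. exceed_cov u x y)"
    unfolding u_def using n by (intro tv_high_le_cov(2)[OF gaussian_family_axioms \<delta>]) simp
  also note mult_left_mono[OF le, of 2]
  finally show ?thesis by (simp add: u_def)
qed

theorem theorem1p3:
  fixes M :: "nat \<Rightarrow> 'a measure"
    and \<phi> :: "nat \<Rightarrow> int ^ 'd::finite \<Rightarrow> 'a \<Rightarrow> real"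
    and \<delta> \<alpha> :: real
  assumes "CARD('d) \<ge> 3"
    and "0 < \<delta>" and "\<delta> < 1"
    and "3 / 4 * ((real CARD('d) - 2 / 3) / (real CARD('d) - 1)) < \<alpha>" and "\<alpha> < 1"
    and "\<And>n. is_dgff n (M n) (\<phi> n)"
  shows "(\<lambda>n. tv_high (M n) \<delta> \<alpha> n (\<phi> n)) \<longlonglongrightarrow> 0"
proof -
  note d3 = assms(1)
  define d where "d = real CARD('d)"
  define \<rho> where "\<rho> = hit_ratio TYPE('d)"
  have d: "3 \<le> d" using d3 by (simp add: d_def)
  have \<alpha>: "3 * d - 2 < 4 * (d - 1) * \<alpha>"
    using assms(4) d unfolding d_def[symmetric] by (simp add: field_simps)
  have \<rho>: "1 + \<rho> = (3 * d - 2) / (2 * (d - 1))"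
    using d by (simp add: \<rho>_def hit_ratio_def d_def[symmetric] field_simps)
  have \<alpha>34: "3/4 < \<alpha>"
  proof -
    have "3 * (d - 1) < 3 * d - 2" by simp
    also note \<alpha>
    finally have "(d - 1) * 3 < (d - 1) * (4 * \<alpha>)" by (simp add: mult_ac)
    then have "3 < 4 * \<alpha>" by (rule mult_left_less_imp_less) (use d in simp)
    then show ?thesis by simp
  qed
  have long: "d + 2 < 2 * \<alpha> * d"
  proof -
    have "2 * (d - 1) * (d + 2) < d * (3 * d - 2)"
    proof -
      have "0 < (d - 2) * (d - 2)" using d by (intro mult_pos_pos) auto
      then show ?thesis by (simp add: algebra_simps)
    qed
    also have "\<dots> < d * (4 * (d - 1) * \<alpha>)" using \<alpha> d by (intro mult_strict_left_mono) auto
    finally have "(2 * (d - 1)) * (d + 2) < (2 * (d - 1)) * (2 * \<alpha> * d)" by (simp add: mult_ac)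
    then show ?thesis using d by (subst (asm) mult_less_cancel_left_pos) auto
  qed
  \<comment> \<open>By the formula for 1 + \<rho>, 2 \<alpha> d / (1 + \<rho>) = 4 (d - 1) \<alpha>
    d / (3 d - 2), so positivity of \<open>a\<close> is the assumption on \<alpha>.\<close>
  define a where "a = 2 * \<alpha> * d / (1 + \<rho>) - d"
  have a: "a > 0"
  proof -
    have "d * (3 * d - 2) < d * (4 * (d - 1) * \<alpha>)" using \<alpha> d by (intro mult_strict_left_mono) auto
    then show ?thesis using d by (simp add: a_def \<rho> field_simps)
  qed
  define b where "b = 4 * \<alpha> * d - 2 * d"
  have b: "b > 0"
  proof -
    have "d * (3/4) < d * \<alpha>" using \<alpha>34 d by (intro mult_strict_left_mono) auto
    then show ?thesis using d by (simp add: b_def)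
  qed
  \<comment> \<open>The divisor 8 spends half of the margin 2 \<alpha> d - (d + 2): as (1 - 2
    \<epsilon>)^2 >= 1 - 4 \<epsilon>, the exponent loses at most 4 \<alpha> d \<epsilon>.\<close>
  define \<epsilon> where "\<epsilon> = min (1/4) ((2 * \<alpha> * d - (d + 2)) / (8 * \<alpha> * d))"
  have ad: "0 < \<alpha> * d" using \<alpha>34 d by simp
  have \<epsilon>: "0 < \<epsilon>" "\<epsilon> \<le> 1/4" using long ad by (auto simp: \<epsilon>_def)
  define c where "c = \<alpha> * d * (1 + (1 - 2 * \<epsilon>)\<^sup>2) - (d + 2)"
  have c: "c > 0"
  proof -
    have "\<epsilon> \<le> (2 * \<alpha> * d - (d + 2)) / (8 * \<alpha> * d)" by (simp add: \<epsilon>_def)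
    then have "8 * (\<alpha> * d * \<epsilon>) \<le> 2 * \<alpha> * d - (d + 2)" using ad by (simp add: le_divide_eq mult_ac)
    moreover have "\<alpha> * d * (1 + (1 - 2 * \<epsilon>)\<^sup>2) \<ge> \<alpha> * d * (2 - 4 * \<epsilon>)"
      using ad by (intro mult_left_mono) (auto simp: power2_eq_square algebra_simps)
    moreover have "\<alpha> * d * (2 - 4 * \<epsilon>) = 2 * \<alpha> * d - 4 * (\<alpha> * d * \<epsilon>)" by (simp add: algebra_simps)
    ultimately show ?thesis using long by (simp add: c_def)
  qed
  obtain r :: nat where r: "\<And>n (x :: int ^ 'd) y. \<exists>i. \<bar>x $ i - y $ i\<bar> > int r \<Longrightarrow> green_box n x y \<le> \<epsilon>"
    using green_box_le_far[OF d3 \<epsilon>(1)] by blast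
  define R where "R = real ((2 * r + 1) ^ CARD('d))"
  define s where "s = sqrt (2 * \<alpha> * d * green0 TYPE('d))"
  define U where "U = (\<lambda>n. 2 * (R * real n powr (- a) + real n powr (- b)
     + 4 * d * (s * sqrt (ln (real n))) * real n powr (- c)))"
  have "U \<longlonglongrightarrow> 2 * (R * 0 + 0 + 4 * d * s * 0)"
  proof -
    have "(\<lambda>n. real n powr (- a)) \<longlonglongrightarrow> 0" using a by real_asymp
    moreover have "(\<lambda>n. real n powr (- b)) \<longlonglongrightarrow> 0" using b by real_asymp
    moreover have "(\<lambda>n. sqrt (ln (real n)) * real n powr (- c)) \<longlonglongrightarrow> 0" using c by real_asymp
    ultimately have "(\<lambda>n. 2 * (R * real n powr (- a) + real n powr (- b)
         + 4 * d * s * (sqrt (ln (real n)) * real n powr (- c)))) \<longlonglongrightarrow> 2 * (R * 0 + 0 + 4 * d * s * 0)"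
      by (intro tendsto_intros)
    then show ?thesis by (simp add: U_def mult_ac)
  qed
  then have U: "U \<longlonglongrightarrow> 0" by simp
  show ?thesis
  proof (rule tendsto_sandwich[OF _ _ tendsto_const U])
    show "\<forall>\<^sub>F n in sequentially. 0 \<le> tv_high (M n) \<delta> \<alpha> n (\<phi> n)"
      using eventually_ge_at_top[of 2]
      by eventually_elim (rule tv_high_le_cov(1)[OF dgff_gaussian_family[OF d3 assms(6)] assms(2)], simp)
    show "\<forall>\<^sub>F n in sequentially. tv_high (M n) \<delta> \<alpha> n (\<phi> n) \<le> U n"
      using eventually_ge_at_top[of 2]
    proof eventually_elim
      case (elim n)
      have "hp_level TYPE('d) \<alpha> n = s * sqrt (ln (real n))"
        by (simp add: hp_level_def s_def d_def real_sqrt_mult)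
      moreover have "d - 2 * \<alpha> * d / (1 + \<rho>) = - a" "2 * d - 4 * \<alpha> * d = - b"
         "d + 2 - \<alpha> * d * (1 + (1 - 2 * \<epsilon>)\<^sup>2) = - c" by (simp_all add: a_def b_def c_def)
      ultimately show ?case
        using tv_high_le[OF d3 assms(6) assms(2) elim _ \<epsilon> r, of \<alpha>] \<alpha>34
        unfolding U_def R_def d_def[symmetric] \<rho>_def[symmetric] by simp
    qed
  qed
qed

end
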